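(* Let $S=(S_0,\dots,S_{N-1})$, $\tilde S=(\tilde S_0,\dots,\tilde S_{N-1})$ be a compactly supported biorthogonal wavelet representation on $\mathcal{H}=L^2(\mathbb{T})$. Then there is a finite-dimensional subspace $\mathcal{K}\subseteq\mathcal{H}$ which is co-invariant and doubly-cyclic for the representation; in other words: (i) $S_i^*\mathcal{K}\subseteq\mathcal{K}$ and $\tilde S_i^*\mathcal{K}\subseteq\mathcal{K}$ for $0\le i\le N-1$; (ii) $\displaystyle\bigvee_{k\ge1,\;0\le i_1,\dots,i_k\le N-1}S_{i_1}\cdots S_{i_k}\mathcal{K}=\mathcal{H}=\bigvee_{k\ge1,\;0\le i_1,\dots,i_k\le N-1}\tilde S_{i_1}\cdots\tilde S_{i_k}\mathcal{K}.$
   Context: $\mathbb{T}$ is the unit circle with normalized Haar measure; $N\ge2$ is an integer; $\bigvee$ denotes closed linear span. A biorthogonal wavelet representation on $L^2(\mathbb{T})$ is a system of operators $(S_if)(z)=m_i(z)f(z^N)$, $(\tilde S_if)(z)=\tilde m_i(z)f(z^N)$, $0\le i\le N-1$, with $m_i,\tilde m_i\in L^\infty(\mathbb{T})$ the filter functions of a biorthogonal wavelet of scale $N$, so that $S_i^*\tilde S_j=\delta_{i,j}I$ and $\sum_{i=0}^{N-1}S_i\tilde S_i^*=I$ (equivalently, for a.e. $z$ the matrices $\frac{1}{\sqrt N}(m_k(e^{i2\pi l/N}z))_{k,l}$ and $\frac{1}{\sqrt N}(\tilde m_k(e^{i2\pi l/N}z))_{k,l}$ are invertible and the adjoint of one is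 the inverse of the other). It is compactly supported (of genus $g$, a positive integer) when the wavelet is compactly supported; in that case all $m_i$ and $\tilde m_i$ are Fourier polynomials of degree $Ng-1$, i.e. of the form $\sum_{k=-Ng+1}^{Ng-1}a_kz^k$. Compact support is to be understood as this property of the filter functions. *)

theory Defs
  imports "HOL-Probability.Probability_Measure"
begin

text \<open>
  Normalized Haar measure on the unit circle, as the image of the uniform distribution of angles.
\<close>

definition circle :: "complex measure" where
  "circle = distr (uniform_measure lborel {0..<2 * pi}) (restrict_space borel (sphere 0 1)) cis"

lemma space_circle: "space circle = sphere 0 1"
  by (simp add: circle_def space_restrict_space)

lemma measurable_cis_circle:
  "cis \<in> uniform_measure lborel {0..<2 * pi} \<rightarrow>\<^sub>M restrict_space borel (sphere 0 1)"
proof (rule measurable_restrict_space2)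
  have "cis \<in> borel_measurable borel"
    by (intro borel_measurable_continuous_onI continuous_intros)
  then show "cis \<in> borel_measurable (uniform_measure lborel {0..<2 * pi})"
    by (simp cong: measurable_cong_sets)
qed simp

lemma prob_space_circle: "prob_space circle"
  unfolding circle_def
  by (intro prob_space.prob_space_distr measurable_cis_circle prob_space_uniform_measure) auto

definition square_integrable :: "(complex \<Rightarrow> complex) set" where
  "square_integrable =
     {f \<in> borel_measurable circle. integrable circle (\<lambda>z. (cmod (f z))\<^sup>2)}"

lemma square_integrable_zero: "(\<lambda>_. 0) \<in> square_integrable"
  by (simp add: square_integrable_def)

lemma square_integrable_add:
  assumes "f \<in> square_integrable" "g \<in> square_integrable"
  shows "(\<lambda>z. f z + g z) \<in> square_integrable"
proof -
  have [measurable]: "f \<in> borel_measurable circle" "g \<in> borel_measurable circle"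
    and i: "integrable circle (\<lambda>z. (cmod (f z))\<^sup>2)" "integrable circle (\<lambda>z. (cmod (g z))\<^sup>2)"
    using assms by (auto simp: square_integrable_def)
  have b: "(cmod (f z + g z))\<^sup>2 \<le> 2 * (cmod (f z))\<^sup>2 + 2 * (cmod (g z))\<^sup>2" for z
  proof -
    have "(cmod (f z + g z))\<^sup>2 \<le> (cmod (f z) + cmod (g z))\<^sup>2"
      by (intro power_mono norm_triangle_ineq) auto
    also have "\<dots> \<le> 2 * (cmod (f z))\<^sup>2 + 2 * (cmod (g z))\<^sup>2"
      using sum_squares_bound[of "cmod (f z)" "cmod (g z)"] by (simp add: power2_sum)
    finally show ?thesis .
  qed
  have "integrable circle (\<lambda>z. (cmod (f z + g z))\<^sup>2)"
    by (rule Bochner_Integration.integrable_bound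
          [where f = "\<lambda>z. 2 * (cmod (f z))\<^sup>2 + 2 * (cmod (g z))\<^sup>2"])
       (use i b in \<open>auto intro!: AE_I2\<close>)
  then show ?thesis by (simp add: square_integrable_def)
qed

lemma square_integrable_cmult:
  assumes "f \<in> square_integrable"
  shows "(\<lambda>z. c * f z) \<in> square_integrable"
  using assms by (auto simp: square_integrable_def norm_mult power_mult_distrib)

lemma integrable_mult_cnj:
  assumes "f \<in> square_integrable" "g \<in> square_integrable"
  shows "integrable circle (\<lambda>z. f z * cnj (g z))"
proof -
  have [measurable]: "f \<in> borel_measurable circle" "g \<in> borel_measurable circle"
    and i: "integrable circle (\<lambda>z. (cmod (f z))\<^sup>2)" "integrable circle (\<lambda>z. (cmod (g z))\<^sup>2)"
    using assms by (auto simp: square_integrable_def)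
  have b: "cmod (f z) * cmod (g z) \<le> (cmod (f z))\<^sup>2 + (cmod (g z))\<^sup>2" for z
    using sum_squares_bound[of "cmod (f z)" "cmod (g z)"]
      mult_nonneg_nonneg[of "cmod (f z)" "cmod (g z)"] norm_ge_zero[of "f z"] norm_ge_zero[of "g z"]
    by linarith
  have cnj[measurable]: "cnj \<in> borel_measurable borel"
    by (intro borel_measurable_continuous_onI continuous_intros)
  show ?thesis
    by (rule Bochner_Integration.integrable_bound
          [where f = "\<lambda>z. (cmod (f z))\<^sup>2 + (cmod (g z))\<^sup>2"])
       (use i b in \<open>auto intro!: AE_I2 simp: norm_mult\<close>)
qed

quotient_type L2 = "complex \<Rightarrow> complex" / partial:
  "\<lambda>f g. f \<in> square_integrable \<and> g \<in> square_integrable \<and> (AE z in circle. f z = g z)"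
proof (rule part_equivpI)
  show "\<exists>f. f \<in> square_integrable \<and> f \<in> square_integrable \<and> (AE z in circle. f z = f z)"
    using square_integrable_zero by auto
qed (auto intro!: sympI transpI elim: AE_mp)

instantiation L2 :: ab_group_add
begin

lift_definition zero_L2 :: L2 is "\<lambda>_. 0"
  by (simp add: square_integrable_zero)

lift_definition plus_L2 :: "L2 \<Rightarrow> L2 \<Rightarrow> L2" is "\<lambda>f g z. f z + g z"
  by (auto simp: square_integrable_add)

lift_definition uminus_L2 :: "L2 \<Rightarrow> L2" is "\<lambda>f z. - f z"
  using square_integrable_cmult[where c = "-1"] by auto

definition minus_L2 :: "L2 \<Rightarrow> L2 \<Rightarrow> L2" where
  "minus_L2 f g = f + - g"

instance
proof
  fix f g h :: L2
  show "f + g + h = f + (g + h)"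
    by transfer (auto simp: square_integrable_add algebra_simps)
  show "f + g = g + f"
    by transfer (auto simp: square_integrable_add algebra_simps)
  show "0 + f = f"
    by transfer auto
  show "- f + f = 0"
    by transfer (auto simp: square_integrable_zero)
  show "f - g = f + - g"
    by (simp add: minus_L2_def)
qed

end

lift_definition scaleC :: "complex \<Rightarrow> L2 \<Rightarrow> L2" is "\<lambda>c f z. c * f z"
  by (auto simp: square_integrable_cmult)

interpretation L2: vector_space scaleC
proof
  fix a b :: complex and f g :: L2
  show "scaleC a (f + g) = scaleC a f + scaleC a g"
    by transfer (auto simp: square_integrable_add square_integrable_cmult algebra_simps)
  show "scaleC (a + b) f = scaleC a f + scaleC b f"
    by transfer (auto simp: square_integrable_add square_integrable_cmult algebra_simps)
  show "scaleC a (scaleC b f) = scaleC (a * b) f"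
    by transfer (auto simp: square_integrable_cmult algebra_simps)
  show "scaleC 1 f = f"
    by transfer auto
qed

lift_definition cinner :: "L2 \<Rightarrow> L2 \<Rightarrow> complex" is
  "\<lambda>f g. integral\<^sup>L circle (\<lambda>z. f z * cnj (g z))"
proof -
  fix f f' g g' :: "complex \<Rightarrow> complex"
  assume f: "f \<in> square_integrable \<and> f' \<in> square_integrable \<and> (AE z in circle. f z = f' z)"
    and g: "g \<in> square_integrable \<and> g' \<in> square_integrable \<and> (AE z in circle. g z = g' z)"
  have "AE z in circle. f z * cnj (g z) = f' z * cnj (g' z)"
    using f g by auto
  then show "integral\<^sup>L circle (\<lambda>z. f z * cnj (g z)) = integral\<^sup>L circle (\<lambda>z. f' z * cnj (g' z))"
    using f g integrable_mult_cnj[of f g] integrable_mult_cnj[of f' g']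
    by (intro integral_cong_AE) (auto dest: borel_measurable_integrable)
qed

lemma cinner_commute: "cinner f g = cnj (cinner g f)"
  by transfer (subst Bochner_Integration.integral_cnj [symmetric], simp add: mult.commute)

lemma cinner_add_left: "cinner (f + g) h = cinner f h + cinner g h"
  by transfer (simp add: integrable_mult_cnj distrib_right)

lemma cinner_scaleC_left: "cinner (scaleC c f) g = c * cinner f g"
  by transfer (simp add: mult.assoc)

lemma cinner_self: "Im (cinner f f) = 0" "Re (cinner f f) \<ge> 0" "cinner f f = 0 \<longleftrightarrow> f = 0"
proof -
  have "Im (cinner f f) = 0 \<and> Re (cinner f f) \<ge> 0 \<and> (cinner f f = 0 \<longleftrightarrow> f = 0)"
  proof transfer
    fix f :: "complex \<Rightarrow> complex"
    assume "f \<in> square_integrable \<and> f \<in> square_integrable \<and> (AE z in circle. f z = f z)"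
    then have f: "f \<in> square_integrable" by simp
    then have i: "integrable circle (\<lambda>z. (cmod (f z))\<^sup>2)" by (simp add: square_integrable_def)
    have eq: "integral\<^sup>L circle (\<lambda>z. f z * cnj (f z)) =
        complex_of_real (integral\<^sup>L circle (\<lambda>z. (cmod (f z))\<^sup>2))"
      by (simp flip: complex_norm_square integral_complex_of_real)
    have "integral\<^sup>L circle (\<lambda>z. (cmod (f z))\<^sup>2) = 0 \<longleftrightarrow> (AE z in circle. f z = 0)"
      using integral_nonneg_eq_0_iff_AE[OF i] by simp
    then show "Im (integral\<^sup>L circle (\<lambda>z. f z * cnj (f z))) = 0 \<and>
        0 \<le> Re (integral\<^sup>L circle (\<lambda>z. f z * cnj (f z))) \<and>
        (integral\<^sup>L circle (\<lambda>z. f z * cnj (f z)) = 0) =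
          (f \<in> square_integrable \<and> (\<lambda>_. 0) \<in> square_integrable \<and> (AE z in circle. f z = 0))"
      unfolding eq using f square_integrable_zero by simp
  qed
  then show "Im (cinner f f) = 0" "Re (cinner f f) \<ge> 0" "cinner f f = 0 \<longleftrightarrow> f = 0" by auto
qed

text \<open>
  The underlying real structure, with inner product the real part of the complex one, makes the
  library's topology the topology of the norm \<open>f \<mapsto> sqrt (Re (cinner f f))\<close>.  Linear spans and
  adjoints below always refer to the complex structure.
\<close>

instantiation L2 :: real_vector
begin

definition scaleR_L2 :: "real \<Rightarrow> L2 \<Rightarrow> L2" where
  "scaleR_L2 r f = scaleC (complex_of_real r) f"

instance
  by standard (simp_all add: scaleR_L2_def L2.scale_right_distrib L2.scale_left_distrib)

end

instantiation L2 :: real_inner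
begin

definition inner_L2 :: "L2 \<Rightarrow> L2 \<Rightarrow> real" where
  "inner_L2 f g = Re (cinner f g)"

definition norm_L2 :: "L2 \<Rightarrow> real" where
  "norm_L2 f = sqrt (inner f f)"

definition sgn_L2 :: "L2 \<Rightarrow> L2" where
  "sgn_L2 f = f /\<^sub>R norm f"

definition dist_L2 :: "L2 \<Rightarrow> L2 \<Rightarrow> real" where
  "dist_L2 f g = norm (f - g)"

definition uniformity_L2 :: "(L2 \<times> L2) filter" where
  "uniformity_L2 = (INF e\<in>{0<..}. principal {(f, g). dist f g < e})"

definition open_L2 :: "L2 set \<Rightarrow> bool" where
  "open_L2 U \<longleftrightarrow> (\<forall>f\<in>U. eventually (\<lambda>(f', g). f' = f \<longrightarrow> g \<in> U) uniformity)"

instance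
proof
  fix r :: real and f g h :: L2
  show "dist f g = norm (f - g)" "sgn f = f /\<^sub>R norm f" "norm f = sqrt (inner f f)"
    by (fact dist_L2_def sgn_L2_def norm_L2_def)+
  show "(uniformity :: (L2 \<times> L2) filter) = (INF e\<in>{0<..}. principal {(f, g). dist f g < e})"
    by (fact uniformity_L2_def)
  show "open U \<longleftrightarrow> (\<forall>f\<in>U. eventually (\<lambda>(f', g). f' = f \<longrightarrow> g \<in> U) uniformity)" for U :: "L2 set"
    by (fact open_L2_def)
  show "inner f g = inner g f"
    unfolding inner_L2_def by (subst cinner_commute) simp
  show "inner (f + g) h = inner f h + inner g h" "inner (r *\<^sub>R f) g = r * inner f g"
    by (simp_all add: inner_L2_def scaleR_L2_def cinner_add_left cinner_scaleC_left)
  show "0 \<le> inner f f" "inner f f = 0 \<longleftrightarrow> f = 0"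
    using cinner_self[of f] by (auto simp: inner_L2_def complex_eq_iff)
qed

end

definition finite_dim_subspace :: "L2 set \<Rightarrow> bool" where
  "finite_dim_subspace K \<longleftrightarrow> L2.subspace K \<and> (\<exists>B. finite B \<and> L2.span B = K)"

definition closed_span :: "L2 set \<Rightarrow> L2 set" where
  "closed_span X = closure (L2.span X)"

text \<open>
  The Hilbert space adjoint for the complex inner product; it exists for every bounded
  complex-linear operator and is then unique.
\<close>

definition cadjoint :: "(L2 \<Rightarrow> L2) \<Rightarrow> L2 \<Rightarrow> L2" where
  "cadjoint T = (SOME U. \<forall>f g. cinner (T f) g = cinner f (U g))"

lemma cadjoint_eqI:
  assumes "\<And>f g. cinner (T f) g = cinner f (U g)"
  shows "cadjoint T = U"
proof -
  have "\<forall>f g. cinner (T f) g = cinner f (cadjoint T g)"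
    unfolding cadjoint_def by (rule someI[of _ U]) (use assms in blast)
  then have "cinner f (cadjoint T g) = cinner f (U g)" for f g
    using assms by simp
  then have "cinner f (cadjoint T g - U g) = 0" for f g
    by (metis add.commute add.right_neutral cinner_add_left cinner_commute
        complex_cnj_add diff_add_cancel add_left_cancel)
  then show ?thesis
    using cinner_self(3) by (metis ext eq_iff_diff_eq_0)
qed


definition L_infinity :: "(complex \<Rightarrow> complex) set" where
  "L_infinity = {m \<in> borel_measurable circle. \<exists>C. AE z in circle. cmod (m z) \<le> C}"

text \<open>
  The operator \<open>f(z) \<mapsto> m(z) f(z^N)\<close>.  For \<open>m\<close> in \<open>L_infinity\<close> and \<open>N \<ge> 1\<close> the function on the
  right is square-integrable, and its class does not depend on the chosen representative of \<open>f\<close>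
  because \<open>z \<mapsto> z^N\<close> preserves the measure.
\<close>

definition filter_operator :: "nat \<Rightarrow> (complex \<Rightarrow> complex) \<Rightarrow> L2 \<Rightarrow> L2" where
  "filter_operator N m f = abs_L2 (\<lambda>z. m z * rep_L2 f (z ^ N))"

text \<open>
  The filter functions of a biorthogonal wavelet of scale \<open>N\<close> enter only through the relations
  between the operators they define; no refinable function on the line is mentioned.
\<close>

definition biorthogonal_wavelet_rep ::
  "nat \<Rightarrow> (nat \<Rightarrow> complex \<Rightarrow> complex) \<Rightarrow> (nat \<Rightarrow> complex \<Rightarrow> complex) \<Rightarrow>
    (nat \<Rightarrow> L2 \<Rightarrow> L2) \<Rightarrow> (nat \<Rightarrow> L2 \<Rightarrow> L2) \<Rightarrow> bool" where
  "biorthogonal_wavelet_rep N m m' S S' \<longleftrightarrow>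
     (\<forall>i<N. m i \<in> L_infinity \<and> m' i \<in> L_infinity) \<and>
     (\<forall>i<N. S i = filter_operator N (m i) \<and> S' i = filter_operator N (m' i)) \<and>
     (\<forall>i<N. \<forall>j<N. cadjoint (S i) \<circ> S' j = (if i = j then id else (\<lambda>_. 0))) \<and>
     (\<forall>f. (\<Sum>i<N. S i (cadjoint (S' i) f)) = f)"

definition fourier_polynomial :: "nat \<Rightarrow> (complex \<Rightarrow> complex) \<Rightarrow> bool" where
  "fourier_polynomial d m \<longleftrightarrow>
     (\<exists>a :: int \<Rightarrow> complex. AE z in circle. m z = (\<Sum>k = - int d..int d. a k * z powi k))"

definition compactly_supported ::
  "nat \<Rightarrow> nat \<Rightarrow> (nat \<Rightarrow> complex \<Rightarrow> complex) \<Rightarrow> (nat \<Rightarrow> complex \<Rightarrow> complex) \<Rightarrow> bool" where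
  "compactly_supported N g m m' \<longleftrightarrow>
     (\<forall>i<N. fourier_polynomial (N * g - 1) (m i) \<and> fourier_polynomial (N * g - 1) (m' i))"

definition word_operator :: "(nat \<Rightarrow> L2 \<Rightarrow> L2) \<Rightarrow> nat list \<Rightarrow> L2 \<Rightarrow> L2" where
  "word_operator S w = foldr (\<lambda>i T. S i \<circ> T) w id"

definition nonempty_words :: "nat \<Rightarrow> nat list set" where
  "nonempty_words N = {w. length w \<ge> 1 \<and> set w \<subseteq> {..<N}}"

end

theory Submission
  imports Defs
begin

text \<open>
  Let \<open>e k\<close> be the class of \<open>z \<mapsto> z powi k\<close>.  A filter operator whose filter is a Fourier polynomial of degree
  \<open>d\<close> maps \<open>e k\<close> to a combination of the \<open>e (N * k + l)\<close> with \<open>\<bar>l\<bar> \<le> d\<close>.  Dually, its adjoint maps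
  trigonometric polynomials of degree \<open>D\<close> to trigonometric polynomials of degree at most \<open>(D + d) / N\<close>
  (\<open>adjoint_filter_trig\<close>).  For \<open>d = N * g - 1\<close> and \<open>N \<ge> 2\<close> this quotient is at most \<open>2 * g\<close> when
  \<open>D \<le> 2 * g\<close>, and after rounding down it is less than \<open>D\<close> when \<open>D > 2 * g\<close>.  Therefore the space \<open>K\<close> of
  trigonometric polynomials of degree at most \<open>2 * g\<close> is co-invariant, and the adjoints lower every degree
  above \<open>2 * g\<close>.

  Cyclicity is then purely algebraic (\<open>cyclic_subspace\<close>): the identity expressing \<open>f\<close> as the sum of
  \<open>S i (cadjoint (S' i) f)\<close> shows by induction on the degree that every trigonometric polynomial already
  lies in the linear span, without closure, of the images of \<open>K\<close> under nonempty words.  The family \<open>S'\<close>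
  satisfies the adjoint identity, so the same argument applies to it.  It remains to know that the trigonometric
  polynomials are dense (\<open>closed_span_monomial\<close>).

  The adjoints are exhibited concretely: averaging over the \<open>N\<close> branches of the \<open>N\<close>-th root
  gives an explicit formula (\<open>adjoint_pair_transfer_operator\<close>), which rests on the self-similarity of
  the circle under \<open>z \<mapsto> z^N\<close> (\<open>integral_circle_root_branches\<close>).
\<close>

section \<open>Integration over the circle\<close>

lemma borel_measurable_circle_eq: "borel_measurable circle = borel_measurable (restrict_space borel (sphere 0 1))"
  by (intro measurable_cong_sets) (simp_all add: circle_def)

lemma borel_measurable_circleI: "f \<in> borel_measurable borel \<Longrightarrow> f \<in> borel_measurable circle"
  unfolding borel_measurable_circle_eq by (rule measurable_restrict_space1)

text \<open>
  Integrals over the circle become Lebesgue integrals over \<open>[0, 2\<pi>)\<close>, so that affine substitution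
  and the fundamental theorem of calculus apply.
\<close>

lemma integral_circle_angle:
  fixes F :: "complex \<Rightarrow> 'a::{banach, second_countable_topology}"
  assumes [measurable]: "F \<in> borel_measurable circle"
  shows "integrable circle F \<longleftrightarrow> set_integrable lborel {0..<2 * pi} (\<lambda>t. F (cis t))"
    and "integral\<^sup>L circle F = (1 / (2 * pi)) *\<^sub>R (LBINT t:{0..<2 * pi}. F (cis t))"
proof -
  define d where "d t = indicator {0..<2 * pi} t / (2 * pi)" for t :: real
  have [measurable]: "F \<in> borel_measurable (restrict_space borel (sphere 0 1))"
    using assms by (simp add: borel_measurable_circle_eq)
  have dens: "uniform_measure lborel {0..<2 * pi} = density lborel d"
    unfolding uniform_measure_def d_def
    by (intro arg_cong2[where f=density] ext)
       (auto simp: indicator_def divide_ennreal[symmetric] simp flip: ennreal_1)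
  have cis: "cis \<in> density lborel d \<rightarrow>\<^sub>M restrict_space borel (sphere 0 1)"
    using measurable_cis_circle unfolding dens .
  have [measurable]: "d \<in> borel_measurable lborel" unfolding d_def by measurable
  have [measurable]: "(\<lambda>t. F (cis t)) \<in> borel_measurable lborel"
    using measurable_compose[OF cis, of F borel] by (simp cong: measurable_cong_sets)
  have d0: "AE t in lborel. 0 \<le> d t" by (auto simp: d_def)
  have eq: "d t *\<^sub>R F (cis t) = (1 / (2 * pi)) *\<^sub>R (indicator {0..<2 * pi} t *\<^sub>R F (cis t))" for t
    by (simp add: d_def)
  have int_eq: "integrable lborel (\<lambda>t. d t *\<^sub>R F (cis t))
      \<longleftrightarrow> integrable lborel (\<lambda>t. indicator {0..<2 * pi} t *\<^sub>R F (cis t))"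
  proof
    assume "integrable lborel (\<lambda>t. d t *\<^sub>R F (cis t))"
    then have "integrable lborel (\<lambda>t. (2 * pi) *\<^sub>R (d t *\<^sub>R F (cis t)))"
      by (rule integrable_scaleR_right)
    then show "integrable lborel (\<lambda>t. indicator {0..<2 * pi} t *\<^sub>R F (cis t))"
      by (simp add: d_def)
  next
    assume "integrable lborel (\<lambda>t. indicator {0..<2 * pi} t *\<^sub>R F (cis t))"
    then show "integrable lborel (\<lambda>t. d t *\<^sub>R F (cis t))"
      unfolding eq by (rule integrable_scaleR_right)
  qed
  show "integrable circle F \<longleftrightarrow> set_integrable lborel {0..<2 * pi} (\<lambda>t. F (cis t))"
    unfolding circle_def dens integrable_distr_eq[OF cis \<open>F \<in> borel_measurable (restrict_space _ _)\<close>]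
      set_integrable_def
    by (subst integrable_density) (use d0 int_eq in \<open>simp_all only:, simp_all\<close>)
  show "integral\<^sup>L circle F = (1 / (2 * pi)) *\<^sub>R (LBINT t:{0..<2 * pi}. F (cis t))"
    unfolding circle_def dens integral_distr[OF cis \<open>F \<in> borel_measurable (restrict_space _ _)\<close>]
      set_lebesgue_integral_def
    by (subst integral_density) (use d0 in \<open>simp_all only: eq integral_scaleR_right, simp_all\<close>)
qed

text \<open>
  The branches of the \<open>N\<close>-th root, \<open>j < N\<close>, with the cut along the positive real axis.  The argument
  is taken in \<open>[0, 2\<pi>)\<close> because branch \<open>j\<close> then maps the circle bijectively onto the arc of angles in
  \<open>[2\<pi>j/N, 2\<pi>(j+1)/N)\<close>, and these arcs partition the circle.
\<close>

definition root_branch :: "nat \<Rightarrow> nat \<Rightarrow> complex \<Rightarrow> complex" where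
  "root_branch N j z = cis ((Arg2pi z + 2 * pi * real j) / real N)"

lemma root_branch_power:
  assumes "N > 0" "z \<in> sphere 0 1"
  shows "root_branch N j z ^ N = z"
proof -
  have "root_branch N j z ^ N = cis (Arg2pi z + 2 * pi * real j)"
    using assms(1) by (simp add: root_branch_def Complex.DeMoivre)
  also have "\<dots> = cis (Arg2pi z)"
    by (simp add: cis_mult [symmetric] cis_multiple_2pi)
  also have "\<dots> = z"
    using assms(2) Arg2pi_eq[of z] by (simp add: cis_conv_exp)
  finally show ?thesis .
qed

lemma root_branch_cis:
  assumes "t \<in> {0..<2 * pi}"
  shows "root_branch N j (cis t) = cis ((t + 2 * pi * real j) / real N)"
proof -
  have "Arg2pi (cis t) = t"
    using assms by (intro Arg2pi_unique[of 1]) (auto simp: cis_conv_exp)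
  then show ?thesis by (simp add: root_branch_def)
qed

text \<open>
  The argument jumps only across the positive real axis, and it is continuous on the closed upper half
  plane without the origin and on the open lower half plane.
\<close>

lemma measurable_Arg2pi [measurable]: "Arg2pi \<in> borel_measurable borel"
proof (rule measurable_piecewise_restrict[where C="{{0}, {z. 0 \<le> Im z} - {0}, {z. Im z < 0}}"])
  show "space borel \<subseteq> \<Union> {{0}, {z. 0 \<le> Im z} - {0}, {z. Im z < 0}}" by auto
  have "continuous_on {z. Im z < 0} Arg2pi"
    by (intro continuous_at_imp_continuous_on ballI continuous_at_Arg2pi)
       (auto simp: complex_nonneg_Reals_iff)
  then show "Arg2pi \<in> borel_measurable (restrict_space borel \<Omega>)"
    if "\<Omega> \<in> {{0}, {z. 0 \<le> Im z} - {0}, {z. Im z < 0}}" for \<Omega>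
    using that continuous_on_upperhalf_Arg2pi
    by (auto intro!: borel_measurable_continuous_on_restrict)
  have "{z. 0 \<le> Im z} - {0} \<in> sets borel" "{z. Im z < 0} \<in> sets borel"
    by (auto intro: borel_open open_halfspace_Im_lt borel_closed closed_halfspace_Im_ge)
  then show "\<Omega> \<inter> space borel \<in> sets borel"
    if "\<Omega> \<in> {{0}, {z. 0 \<le> Im z} - {0}, {z. Im z < 0}}" for \<Omega>
    using that by auto
qed auto

lemma measurable_root_branch: "root_branch N j \<in> circle \<rightarrow>\<^sub>M circle"
proof -
  have "root_branch N j \<in> borel_measurable borel"
    unfolding root_branch_def
    by (rule measurable_compose[where g=cis and N=borel])
       (auto intro!: borel_measurable_continuous_onI continuous_intros)
  then have "root_branch N j \<in> borel_measurable circle"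
    by (rule borel_measurable_circleI)
  then have "root_branch N j \<in> circle \<rightarrow>\<^sub>M restrict_space borel (sphere 0 1)"
    by (intro measurable_restrict_space2) (auto simp: root_branch_def)
  then show ?thesis
    by (simp add: circle_def cong: measurable_cong_sets)
qed

text \<open>
  Cut the circle into \<open>N\<close> equal arcs.  The \<open>j\<close>-th arc is the image of branch \<open>j\<close> of the root, which in
  the angle variable is the affine map \<open>t \<mapsto> (t + 2\<pi>j)/N\<close>; hence it contributes \<open>1/N\<close> times the integral
  of \<open>F\<close> composed with that branch.  This one formula yields the invariance of the measure under
  \<open>z \<mapsto> z^N\<close> as well as the adjoint of a filter operator.
\<close>

lemma integral_circle_root_branches:
  fixes F :: "complex \<Rightarrow> 'a::{banach, second_countable_topology}"
  assumes N: "N > 0" and F: "integrable circle F"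
  shows "j < N \<Longrightarrow> integrable circle (\<lambda>z. F (root_branch N j z))"
    and "integral\<^sup>L circle F = (1 / real N) *\<^sub>R (\<Sum>j<N. \<integral>z. F (root_branch N j z) \<partial>circle)"
proof -
  have [measurable]: "F \<in> borel_measurable circle" using F by auto
  have m [measurable]: "(\<lambda>z. F (root_branch N j z)) \<in> borel_measurable circle" for j
    using measurable_compose[OF measurable_root_branch, of F borel] by simp
  define c where "c n = 2 * pi * real n / real N" for n
  have c: "0 \<le> c n" "c n \<le> c (Suc n)" for n
    by (auto simp: c_def divide_right_mono)
  have cN: "c N = 2 * pi" "c 0 = 0" using N by (auto simp: c_def)
  have c2pi: "n \<le> N \<Longrightarrow> c n \<le> 2 * pi" for n
    using N by (auto simp: c_def field_simps)
  define G where "G t = F (cis t)" for t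
  have G: "set_integrable lborel {0..<2 * pi} G"
    using F integral_circle_angle(1)[of F] by (simp add: G_def[abs_def])
  have Gj: "set_integrable lborel {c j..<c (Suc j)} G" if "j < N" for j
    by (rule set_integrable_subset[OF G]) (use c(1)[of j] c2pi[of "Suc j"] that in auto)
  \<comment> \<open>The substitution \<open>t \<mapsto> c j + t/N\<close> carries \<open>[0, 2\<pi>)\<close> onto the \<open>j\<close>-th arc.\<close>
  have ind: "indicator {c j..<c (Suc j)} (c j + (1 / real N) * t) *\<^sub>R G (c j + (1 / real N) * t)
      = indicator {0..<2 * pi} t *\<^sub>R F (root_branch N j (cis t))" for j t
  proof -
    have *: "c j + (1 / real N) * t \<in> {c j..<c (Suc j)} \<longleftrightarrow> t \<in> {0..<2 * pi}"
      using N by (auto simp: c_def field_simps)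
    have **: "G (c j + (1 / real N) * t) = F (root_branch N j (cis t))" if "t \<in> {0..<2 * pi}"
      using that by (simp add: root_branch_cis G_def c_def add_divide_distrib add.commute)
    show ?thesis
      by (cases "t \<in> {0..<2 * pi}")
         (simp_all only: * ** indicator_def simp_thms of_bool_eq scaleR_zero_left scaleR_one)
  qed
  show int: "integrable circle (\<lambda>z. F (root_branch N j z))" if "j < N" for j
    using lborel_integrable_real_affine[OF Gj[OF that, unfolded set_integrable_def], of "1 / real N" "c j"] N
    unfolding ind by (simp add: integral_circle_angle(1) set_integrable_def)
  have piece: "(LBINT t:{c j..<c (Suc j)}. G t)
      = (1 / real N) *\<^sub>R (2 * pi) *\<^sub>R (\<integral>z. F (root_branch N j z) \<partial>circle)" for j
    using lborel_integral_real_affine[of "1 / real N" "\<lambda>t. indicator {c j..<c (Suc j)} t *\<^sub>R G t" "c j"] N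
    unfolding ind by (simp add: integral_circle_angle(2) set_lebesgue_integral_def)
  have "(LBINT t:{0..<c n}. G t) = (\<Sum>j<n. LBINT t:{c j..<c (Suc j)}. G t)" if "n \<le> N" for n
    using that
  proof (induction n)
    case 0
    then show ?case by (simp add: cN set_lebesgue_integral_def)
  next
    case (Suc n)
    have "{0..<c (Suc n)} = {0..<c n} \<union> {c n..<c (Suc n)}"
      using c[of n] by auto
    moreover have "(LBINT t:{0..<c n} \<union> {c n..<c (Suc n)}. G t)
        = (LBINT t:{0..<c n}. G t) + (LBINT t:{c n..<c (Suc n)}. G t)"
      by (intro set_integral_Un Gj set_integrable_subset[OF G])
         (use Suc.prems c2pi[of n] in auto)
    ultimately show ?case using Suc by simp
  qed
  from this[of N] have "(LBINT t:{0..<2 * pi}. G t)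
      = (\<Sum>j<N. (1 / real N) *\<^sub>R (2 * pi) *\<^sub>R (\<integral>z. F (root_branch N j z) \<partial>circle))"
    by (simp add: cN piece)
  then show "integral\<^sup>L circle F = (1 / real N) *\<^sub>R (\<Sum>j<N. \<integral>z. F (root_branch N j z) \<partial>circle)"
    by (simp add: integral_circle_angle(2) G_def scaleR_sum_right[symmetric])
qed

lemma integral_circle_powi: "(\<integral>z. z powi k \<partial>circle) = (if k = 0 then 1 else 0)"
proof -
  have c: "continuous_on (sphere 0 1) (\<lambda>z::complex. z powi k)"
    by (intro continuous_intros) auto
  then have [measurable]: "(\<lambda>z. z powi k) \<in> borel_measurable circle"
    unfolding borel_measurable_circle_eq by (rule borel_measurable_continuous_on_restrict)
  have "(LBINT t:{0..<2 * pi}. cis t powi k) = (LBINT t:{0..2 * pi}. cis (of_int k * t))"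
    unfolding set_lebesgue_integral_def
    by (rule integral_discrete_difference[where X="{2 * pi}"])
       (auto simp: indicator_def Complex.cis_power_int)
  also have "\<dots> = (if k = 0 then 2 * pi else 0)"
  proof (cases "k = 0")
    case False
    have "(LBINT t:{0..2 * pi}. cis (of_int k * t))
        = cis (of_int k * (2 * pi)) / (\<i> * of_int k) - cis (of_int k * 0) / (\<i> * of_int k)"
      unfolding set_lebesgue_integral_def
    proof (rule integral_FTC_atLeastAtMost)
      show "((\<lambda>t. cis (of_int k * t) / (\<i> * of_int k)) has_vector_derivative cis (of_int k * x))
          (at x within {0..2 * pi})" for x
        using False unfolding cis_conv_exp
        by (auto intro!: derivative_eq_intros has_vector_derivative_real_field simp: field_simps)
    qed (auto intro!: continuous_intros)
    also have "cis (of_int k * (2 * pi)) = 1"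
      using cis_multiple_2pi[of "of_int k"] by (simp add: mult_ac)
    finally show ?thesis using False by simp
  qed (simp add: set_lebesgue_integral_def scaleR_conv_of_real)
  finally show ?thesis
    by (simp add: integral_circle_angle(2) scaleR_conv_of_real)
qed

lemma measurable_power_circle: "(\<lambda>z. z ^ N) \<in> circle \<rightarrow>\<^sub>M circle"
proof -
  have "(\<lambda>z. z ^ N) \<in> borel_measurable circle"
    by (intro borel_measurable_circleI borel_measurable_continuous_onI continuous_intros)
  then have "(\<lambda>z. z ^ N) \<in> circle \<rightarrow>\<^sub>M restrict_space borel (sphere 0 1)"
    by (intro measurable_restrict_space2) (auto simp: space_circle norm_power)
  then show ?thesis
    by (simp add: circle_def cong: measurable_cong_sets)
qed

text \<open>
  Every branch \<open>\<rho>\<close> of the root satisfies \<open>\<rho>(z)^N = z\<close>, so the preimage of \<open>A\<close> under the power map pulls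
  back to \<open>A\<close> along each of the \<open>N\<close> branches.
\<close>

lemma distr_power_circle:
  assumes "N > 0"
  shows "distr circle circle (\<lambda>z. z ^ N) = circle"
proof (rule measure_eqI)
  interpret prob_space circle by (rule prob_space_circle)
  fix A assume "A \<in> sets (distr circle circle (\<lambda>z. z ^ N))"
  then have A [measurable]: "A \<in> sets circle" by simp
  let ?B = "(\<lambda>z. z ^ N) -` A \<inter> space circle"
  have B: "?B \<in> sets circle" using measurable_sets[OF measurable_power_circle A] .
  have "measure circle ?B = (\<integral>z. indicator ?B z \<partial>circle)"
    using B by simp
  also have "\<dots> = (1 / real N) * (\<Sum>j<N. \<integral>z. indicator ?B (root_branch N j z) \<partial>circle)"
    using B by (subst integral_circle_root_branches(2)[OF assms]) (auto simp: emeasure_eq_measure)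
  also have "(\<Sum>j<N. \<integral>z. indicator ?B (root_branch N j z) \<partial>circle) = (\<Sum>j<N. measure circle A)"
  proof (rule sum.cong[OF refl])
    fix j
    have "(\<integral>z. indicator ?B (root_branch N j z) \<partial>circle) = (\<integral>z. indicat_real A z \<partial>circle)"
      by (intro Bochner_Integration.integral_cong refl)
         (use assms in \<open>auto simp: indicator_def space_circle root_branch_power,
            auto simp: root_branch_def\<close>)
    then show "(\<integral>z. indicator ?B (root_branch N j z) \<partial>circle) = measure circle A"
      using A by simp
  qed
  finally have "measure circle ?B = measure circle A" using assms by simp
  then show "emeasure (distr circle circle (\<lambda>z. z ^ N)) A = emeasure circle A"
    using A measurable_power_circle by (simp add: emeasure_distr emeasure_eq_measure)
qed simp

section \<open>Filter operators and their adjoints\<close>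

lemma rep_L2_square_integrable: "rep_L2 f \<in> square_integrable"
  using Quotient3_rep_reflp[OF Quotient3_L2] by blast

lemma abs_rep_L2: "abs_L2 (rep_L2 f) = f"
  by (rule Quotient3_abs_rep[OF Quotient3_L2])

lemma abs_L2_eqI:
  "f \<in> square_integrable \<Longrightarrow> g \<in> square_integrable \<Longrightarrow> AE z in circle. f z = g z \<Longrightarrow> abs_L2 f = abs_L2 g"
  using Quotient3_rel_abs[OF Quotient3_L2] by blast

lemma rep_abs_L2: "f \<in> square_integrable \<Longrightarrow> AE z in circle. rep_L2 (abs_L2 f) z = f z"
  using Quotient3_rep_abs[OF Quotient3_L2, of f] by blast

lemma L_infinity_measurable: "m \<in> L_infinity \<Longrightarrow> m \<in> borel_measurable circle"
  by (simp add: L_infinity_def)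

lemma square_integrable_measurable: "f \<in> square_integrable \<Longrightarrow> f \<in> borel_measurable circle"
  by (simp add: square_integrable_def)

lemma borel_measurable_cnj [measurable]: "cnj \<in> borel_measurable borel"
  by (intro borel_measurable_continuous_onI continuous_intros)

lemma square_integrable_mult_L_infinity:
  assumes "m \<in> L_infinity" "f \<in> square_integrable"
  shows "(\<lambda>z. m z * f z) \<in> square_integrable"
proof -
  have [measurable]: "m \<in> borel_measurable circle" "f \<in> borel_measurable circle"
    using assms by (simp_all add: L_infinity_measurable square_integrable_measurable)
  obtain C where C: "AE z in circle. cmod (m z) \<le> C" using assms(1) by (auto simp: L_infinity_def)
  have i: "integrable circle (\<lambda>z. C\<^sup>2 * (cmod (f z))\<^sup>2)"
    using assms(2) by (auto simp: square_integrable_def)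
  have "integrable circle (\<lambda>z. (cmod (m z * f z))\<^sup>2)"
    by (rule Bochner_Integration.integrable_bound[OF i])
       (use C in \<open>auto simp: norm_mult power_mult_distrib intro!: mult_right_mono power_mono\<close>)
  then show ?thesis by (simp add: square_integrable_def)
qed

lemma L_infinity_square_integrable: "m \<in> L_infinity \<Longrightarrow> m \<in> square_integrable"
  using square_integrable_mult_L_infinity[of m "\<lambda>_. 1"] prob_space_circle
  by (simp add: square_integrable_def prob_space.finite_measure finite_measure.integrable_const)

lemma L_infinity_cnj: "m \<in> L_infinity \<Longrightarrow> (\<lambda>z. cnj (m z)) \<in> L_infinity"
  by (auto simp: L_infinity_def)

lemma square_integrable_power:
  assumes "N > 0" "f \<in> square_integrable"
  shows "(\<lambda>z. f (z ^ N)) \<in> square_integrable"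
proof -
  have f [measurable]: "f \<in> borel_measurable circle"
    using assms by (simp add: square_integrable_measurable)
  have "integrable (distr circle circle (\<lambda>z. z ^ N)) (\<lambda>z. (cmod (f z))\<^sup>2)"
    using assms by (simp add: distr_power_circle square_integrable_def)
  then have "integrable circle (\<lambda>z. (cmod (f (z ^ N)))\<^sup>2)"
    by (subst (asm) integrable_distr_eq[OF measurable_power_circle]) simp_all
  then show ?thesis
    using measurable_compose[OF measurable_power_circle f] by (simp add: square_integrable_def)
qed

lemma AE_circle_power:
  assumes "N > 0" "AE z in circle. P z"
  shows "AE z in circle. P (z ^ N)"
proof (rule AE_distrD[OF measurable_power_circle[of N]])
  show "AE z in distr circle circle (\<lambda>z. z ^ N). P z"
    unfolding distr_power_circle[OF assms(1)] by (rule assms(2))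
qed

lemma square_integrable_root_branch:
  assumes "j < N" "f \<in> square_integrable"
  shows "(\<lambda>z. f (root_branch N j z)) \<in> square_integrable"
  using assms measurable_compose[OF measurable_root_branch, of f borel]
    integral_circle_root_branches(1)[of N "\<lambda>z. (cmod (f z))\<^sup>2" j]
  by (simp add: square_integrable_def)

lemma square_integrable_sum:
  "(\<And>i. i \<in> I \<Longrightarrow> f i \<in> square_integrable) \<Longrightarrow> (\<lambda>z. \<Sum>i\<in>I. f i z) \<in> square_integrable"
  by (induction I rule: infinite_finite_induct)
     (auto simp: square_integrable_zero square_integrable_add)

lemma filter_integrand_square_integrable:
  "N > 0 \<Longrightarrow> m \<in> L_infinity \<Longrightarrow> f \<in> square_integrable \<Longrightarrow> (\<lambda>z. m z * f (z ^ N)) \<in> square_integrable"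
  by (intro square_integrable_mult_L_infinity square_integrable_power)

text \<open>
  Since \<open>z \<mapsto> z^N\<close> preserves the measure, it pulls null sets back to null sets, and any representative
  of the class may be used.
\<close>

lemma filter_operator_abs:
  assumes "N > 0" "m \<in> L_infinity" "f \<in> square_integrable"
  shows "filter_operator N m (abs_L2 f) = abs_L2 (\<lambda>z. m z * f (z ^ N))"
  unfolding filter_operator_def
  by (intro abs_L2_eqI filter_integrand_square_integrable assms rep_L2_square_integrable)
     (use AE_circle_power[OF assms(1) rep_abs_L2[OF assms(3)]] in auto)

definition adjoint_pair :: "(L2 \<Rightarrow> L2) \<Rightarrow> (L2 \<Rightarrow> L2) \<Rightarrow> bool" where
  "adjoint_pair T U \<longleftrightarrow> (\<forall>f g. cinner (T f) g = cinner f (U g))"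

text \<open>
  The transfer operator of \<open>z \<mapsto> z^N\<close> with weight \<open>cnj m\<close>; the branches run through the preimages of \<open>z\<close>.
\<close>

definition transfer_operator :: "nat \<Rightarrow> (complex \<Rightarrow> complex) \<Rightarrow> L2 \<Rightarrow> L2" where
  "transfer_operator N m g = abs_L2 (\<lambda>z. (1 / of_nat N) *
     (\<Sum>j<N. cnj (m (root_branch N j z)) * rep_L2 g (root_branch N j z)))"

lemma cinner_abs:
  "f \<in> square_integrable \<Longrightarrow> g \<in> square_integrable \<Longrightarrow>
    cinner (abs_L2 f) (abs_L2 g) = (\<integral>z. f z * cnj (g z) \<partial>circle)"
  by (simp add: cinner.abs_eq)

text \<open>
  Split the integral of \<open>m(z) f(z^N) cnj(g(z))\<close> along the branches of the root; as \<open>\<rho>(z)^N = z\<close> on each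
  branch, \<open>f\<close> is evaluated at \<open>z\<close> and comes out of the average.  The explicit formula provides an
  adjoint without the Riesz representation theorem, hence without completeness of the space.
\<close>

lemma adjoint_pair_transfer_operator:
  assumes N: "N > 0" and m: "m \<in> L_infinity"
  shows "adjoint_pair (filter_operator N m) (transfer_operator N m)"
  unfolding adjoint_pair_def
proof (intro allI)
  fix f' g' :: L2
  obtain f g where f: "f \<in> square_integrable" and g: "g \<in> square_integrable"
    and fg: "f = rep_L2 f'" "g = rep_L2 g'" "f' = abs_L2 f" "g' = abs_L2 g"
    using rep_L2_square_integrable abs_rep_L2 by metis
  define F where "F z = m z * f (z ^ N) * cnj (g z)" for z
  define u where "u z = (1 / of_nat N) * (\<Sum>j<N. cnj (m (root_branch N j z)) * g (root_branch N j z))" for z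
  have F: "integrable circle F"
    unfolding F_def by (intro integrable_mult_cnj filter_integrand_square_integrable N m f g)
  have "(\<lambda>z. cnj (m z) * g z) \<in> square_integrable"
    by (intro square_integrable_mult_L_infinity L_infinity_cnj m g)
  then have u: "u \<in> square_integrable"
    unfolding u_def
    by (intro square_integrable_cmult square_integrable_sum
        square_integrable_root_branch[where f="\<lambda>z. cnj (m z) * g z"]) auto
  have "cinner (filter_operator N m f') g' = integral\<^sup>L circle F"
    unfolding fg(3,4) filter_operator_abs[OF N m f]
    by (subst cinner_abs) (simp_all add: F_def[abs_def] filter_integrand_square_integrable N m f g)
  also have "\<dots> = (1 / real N) *\<^sub>R (\<Sum>j<N. \<integral>z. F (root_branch N j z) \<partial>circle)"
    by (rule integral_circle_root_branches(2)[OF N F])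
  also have "\<dots> = (\<integral>z. (1 / real N) *\<^sub>R (\<Sum>j<N. F (root_branch N j z)) \<partial>circle)"
    using integral_circle_root_branches(1)[OF N F] by (subst integral_scaleR_right, subst Bochner_Integration.integral_sum) auto
  also have "\<dots> = (\<integral>z. f z * cnj (u z) \<partial>circle)"
  proof (intro Bochner_Integration.integral_cong refl)
    fix z assume "z \<in> space circle"
    then have "root_branch N j z ^ N = z" for j
      using N by (intro root_branch_power) (simp_all add: space_circle)
    then have "F (root_branch N j z) = f z * cnj (cnj (m (root_branch N j z)) * g (root_branch N j z))" for j
      by (simp add: F_def)
    then show "(1 / real N) *\<^sub>R (\<Sum>j<N. F (root_branch N j z)) = f z * cnj (u z)"
      by (simp add: u_def scaleR_conv_of_real sum_distrib_left mult_ac)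
  qed
  also have "\<dots> = cinner f' (transfer_operator N m g')"
    unfolding transfer_operator_def fg(1,2)[symmetric] unfolding fg(3) u_def[symmetric]
    by (subst cinner_abs) (use f u in auto)
  finally show "cinner (filter_operator N m f') g' = cinner f' (transfer_operator N m g')" .
qed

section \<open>Trigonometric polynomials\<close>

text \<open>
  The functions that agree on the circle with a Laurent polynomial.  The last rule ignores values off the circle,
  which is needed for closure under products: \<open>z powi k * z powi n = z powi (k + n)\<close> may fail at \<open>0\<close>.
\<close>

inductive laurent :: "(complex \<Rightarrow> complex) \<Rightarrow> bool" where
  powi: "laurent (\<lambda>z. z powi k)"
| add: "laurent f \<Longrightarrow> laurent g \<Longrightarrow> laurent (\<lambda>z. f z + g z)"
| scale: "laurent f \<Longrightarrow> laurent (\<lambda>z. c * f z)"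
| cong: "laurent f \<Longrightarrow> (\<And>z. z \<in> sphere 0 1 \<Longrightarrow> g z = f z) \<Longrightarrow> laurent g"

definition monomial :: "int \<Rightarrow> L2" where
  "monomial k = abs_L2 (\<lambda>z. z powi k)"

lemma powi_L_infinity: "(\<lambda>z. z powi k) \<in> L_infinity"
proof -
  have "continuous_on (sphere 0 1) (\<lambda>z::complex. z powi k)"
    by (intro continuous_intros) auto
  then have "(\<lambda>z. z powi k) \<in> borel_measurable circle"
    unfolding borel_measurable_circle_eq by (rule borel_measurable_continuous_on_restrict)
  then show ?thesis
    by (auto simp: L_infinity_def norm_power_int space_circle intro!: exI[of _ 1] AE_I2)
qed

lemma powi_square_integrable: "(\<lambda>z. z powi k) \<in> square_integrable"
  by (intro L_infinity_square_integrable powi_L_infinity)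

lemma abs_L2_add:
  "f \<in> square_integrable \<Longrightarrow> g \<in> square_integrable \<Longrightarrow> abs_L2 f + abs_L2 g = abs_L2 (\<lambda>z. f z + g z)"
  by (simp add: plus_L2.abs_eq)

lemma abs_L2_scaleC:
  "f \<in> square_integrable \<Longrightarrow> scaleC c (abs_L2 f) = abs_L2 (\<lambda>z. c * f z)"
  by (simp add: scaleC.abs_eq)

lemma abs_L2_diff:
  assumes "f \<in> square_integrable" "g \<in> square_integrable"
  shows "abs_L2 f - abs_L2 g = abs_L2 (\<lambda>z. f z - g z)"
  using assms square_integrable_cmult[of g "-1"]
  by (simp add: minus_L2_def uminus_L2.abs_eq abs_L2_add)

lemma abs_L2_sum:
  assumes "\<And>i. i \<in> I \<Longrightarrow> f i \<in> square_integrable"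
  shows "abs_L2 (\<lambda>z. \<Sum>i\<in>I. f i z) = (\<Sum>i\<in>I. abs_L2 (f i))"
  using assms
  by (induction I rule: infinite_finite_induct)
     (auto simp: zero_L2_def square_integrable_sum abs_L2_add[symmetric])

lemma square_integrable_cong:
  assumes "f \<in> square_integrable" "\<And>z. z \<in> sphere 0 1 \<Longrightarrow> g z = f z"
  shows "g \<in> square_integrable"
  using assms measurable_cong[of circle g f borel]
    Bochner_Integration.integrable_cong[of circle circle "\<lambda>z. (cmod (g z))\<^sup>2" "\<lambda>z. (cmod (f z))\<^sup>2"]
  by (auto simp: square_integrable_def space_circle)

lemma AE_circleI: "(\<And>z. z \<in> sphere 0 1 \<Longrightarrow> P z) \<Longrightarrow> AE z in circle. P z"
  by (auto simp: space_circle intro!: AE_I2)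

lemma laurent_in_span:
  "laurent f \<Longrightarrow> f \<in> square_integrable \<and> abs_L2 f \<in> L2.span (range monomial)"
proof (induction rule: laurent.induct)
  case (powi k)
  then show ?case
    using powi_square_integrable L2.span_base[of "monomial k" "range monomial"] by (simp add: monomial_def)
next
  case (add f g)
  then show ?case
    by (simp add: square_integrable_add abs_L2_add[symmetric] L2.span_add)
next
  case (scale f c)
  then show ?case
    by (simp add: square_integrable_cmult abs_L2_scaleC[symmetric] L2.span_scale)
next
  case (cong f g)
  then have "g \<in> square_integrable" using square_integrable_cong[of f g] by blast
  moreover have "abs_L2 g = abs_L2 f"
    using cong calculation by (intro abs_L2_eqI AE_circleI) auto
  ultimately show ?case using cong by simp
qed

lemma laurent_powi_mult: "laurent g \<Longrightarrow> laurent (\<lambda>z. z powi k * g z)"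
proof (induction rule: laurent.induct)
  case (powi n)
  show ?case
    by (rule laurent.cong[OF laurent.powi[of "k + n"]]) (subst power_int_add, auto)
next
  case (add f g)
  then show ?case using laurent.add[OF add.IH] by (simp add: algebra_simps)
next
  case (scale f c)
  then show ?case using laurent.scale[OF scale.IH, of c] by (simp add: mult_ac)
next
  case (cong f g)
  then show ?case using laurent.cong[OF cong.IH] by auto
qed

lemma laurent_mult: "laurent f \<Longrightarrow> laurent g \<Longrightarrow> laurent (\<lambda>z. f z * g z)"
proof (induction rule: laurent.induct)
  case (powi n)
  then show ?case by (rule laurent_powi_mult)
next
  case (add f h)
  then show ?case using laurent.add[of "\<lambda>z. f z * g z" "\<lambda>z. h z * g z"] by (simp add: algebra_simps)
next
  case (scale f c)
  then show ?case using laurent.scale[of "\<lambda>z. f z * g z" c] by (simp add: mult_ac)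
next
  case (cong f h)
  then show ?case using laurent.cong[of "\<lambda>z. f z * g z" "\<lambda>z. h z * g z"] by auto
qed

lemma laurent_const: "laurent (\<lambda>_. c)"
  using laurent.scale[OF laurent.powi[of 0], of c] by simp

text \<open>
  On the circle \<open>cnj z = 1/z\<close>, so every real linear form is a combination of \<open>z\<close> and \<open>1/z\<close>.
\<close>

lemma laurent_real_polynomial:
  fixes p :: "complex \<Rightarrow> real"
  shows "real_polynomial_function p \<Longrightarrow> laurent (\<lambda>z. of_real (p z))"
proof (induction rule: real_polynomial_function.induct)
  case (linear f)
  interpret f: bounded_linear f by fact
  define a b where "a = (of_real (f 1) - \<i> * of_real (f \<i>)) / 2"
    and "b = (of_real (f 1) + \<i> * of_real (f \<i>)) / 2"
  have "of_real (f z) = a * z powi 1 + b * z powi (-1)" if "z \<in> sphere 0 1" for z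
  proof -
    have "z * cnj z = 1"
      using that complex_norm_square[of z] by simp
    then have z: "z powi (-1) = cnj z"
      by (simp add: power_int_minus inverse_unique)
    have "f z = f (Re z *\<^sub>R 1 + Im z *\<^sub>R \<i>)"
      by (rule arg_cong[where f=f]) (simp add: complex_eq_iff)
    then have "f z = Re z * f 1 + Im z * f \<i>"
      by (simp add: f.add f.scaleR)
    then show ?thesis
      unfolding z by (simp add: a_def b_def complex_eq_iff field_simps)
  qed
  then show ?case
    by (intro laurent.cong[OF laurent.add[OF laurent.scale[OF laurent.powi] laurent.scale[OF laurent.powi]]])
qed (auto intro: laurent.add laurent_mult laurent_const)

lemma laurent_polynomial:
  fixes p :: "complex \<Rightarrow> complex"
  assumes "polynomial_function p"
  shows "laurent p"
proof -
  have "real_polynomial_function (Re \<circ> p)" "real_polynomial_function (Im \<circ> p)"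
    using assms bounded_linear_Re bounded_linear_Im by (auto simp: polynomial_function_def)
  then have "laurent (\<lambda>z. of_real ((Re \<circ> p) z) + \<i> * of_real ((Im \<circ> p) z))"
    by (intro laurent.add laurent.scale laurent_real_polynomial)
  then show ?thesis by (simp flip: complex_eq)
qed

section \<open>Density of the trigonometric polynomials\<close>

lemma norm_abs_L2:
  assumes "f \<in> square_integrable"
  shows "(norm (abs_L2 f))\<^sup>2 = (\<integral>z. (cmod (f z))\<^sup>2 \<partial>circle)"
proof -
  have "(norm (abs_L2 f))\<^sup>2 = Re (cinner (abs_L2 f) (abs_L2 f))"
    by (simp add: power2_norm_eq_inner inner_L2_def)
  also have "cinner (abs_L2 f) (abs_L2 f) = complex_of_real (\<integral>z. (cmod (f z))\<^sup>2 \<partial>circle)"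
    by (simp add: cinner_abs assms flip: complex_norm_square integral_complex_of_real)
  finally show ?thesis by simp
qed

text \<open>
  All approximations used for the density of the trigonometric polynomials are dominated pointwise limits.
\<close>

lemma L2_tendsto_dominated:
  fixes f :: "nat \<Rightarrow> complex \<Rightarrow> complex"
  assumes f: "\<And>n. f n \<in> square_integrable" and g: "g \<in> square_integrable" and w: "w \<in> square_integrable"
    and lim: "\<And>z. z \<in> sphere 0 1 \<Longrightarrow> (\<lambda>n. f n z) \<longlonglongrightarrow> g z"
    and bound: "\<And>n z. z \<in> sphere 0 1 \<Longrightarrow> cmod (f n z) \<le> cmod (w z)"
  shows "(\<lambda>n. abs_L2 (f n)) \<longlonglongrightarrow> abs_L2 g"
proof -
  have [measurable]: "f n \<in> borel_measurable circle" "g \<in> borel_measurable circle"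
    "w \<in> borel_measurable circle" for n
    using f g w by (simp_all add: square_integrable_measurable)
  have "(\<lambda>n. \<integral>z. (cmod (f n z - g z))\<^sup>2 \<partial>circle) \<longlonglongrightarrow> (\<integral>z. 0 \<partial>circle)"
  proof (rule integral_dominated_convergence)
    show "integrable circle (\<lambda>z. 4 * (cmod (w z))\<^sup>2)"
      using w by (auto simp: square_integrable_def)
    show "AE z in circle. (\<lambda>n. (cmod (f n z - g z))\<^sup>2) \<longlonglongrightarrow> 0"
    proof (rule AE_circleI)
      fix z :: complex assume "z \<in> sphere 0 1"
      from tendsto_power[OF tendsto_norm[OF tendsto_diff[OF lim[OF this] tendsto_const[of "g z"]]], of 2]
      show "(\<lambda>n. (cmod (f n z - g z))\<^sup>2) \<longlonglongrightarrow> 0" by simp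
    qed
    show "AE z in circle. norm ((cmod (f n z - g z))\<^sup>2) \<le> 4 * (cmod (w z))\<^sup>2" for n
    proof (rule AE_circleI)
      fix z :: complex assume z: "z \<in> sphere 0 1"
      have "cmod (g z) \<le> cmod (w z)"
        by (rule LIMSEQ_le_const2[OF tendsto_norm[OF lim[OF z]]]) (use bound[OF z] in auto)
      then have "cmod (f n z - g z) \<le> 2 * cmod (w z)"
        using bound[OF z, of n] norm_triangle_ineq4[of "f n z" "g z"] by linarith
      then have "(cmod (f n z - g z))\<^sup>2 \<le> (2 * cmod (w z))\<^sup>2"
        by (intro power_mono) auto
      then show "norm ((cmod (f n z - g z))\<^sup>2) \<le> 4 * (cmod (w z))\<^sup>2"
        by (simp add: power_mult_distrib)
    qed
  qed auto
  moreover have "(\<lambda>z. f n z - g z) \<in> square_integrable" for n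
    using square_integrable_add[OF f square_integrable_cmult[OF g, of "-1"]] by simp
  ultimately have "(\<lambda>n. (norm (abs_L2 (f n) - abs_L2 g))\<^sup>2) \<longlonglongrightarrow> 0"
    by (simp add: abs_L2_diff f g norm_abs_L2)
  then have "(\<lambda>n. norm (abs_L2 (f n) - abs_L2 g)) \<longlonglongrightarrow> 0"
    using tendsto_real_sqrt[of "\<lambda>n. (norm (abs_L2 (f n) - abs_L2 g))\<^sup>2" 0 sequentially] by simp
  then show ?thesis
    by (simp add: LIM_zero_iff tendsto_norm_zero_iff)
qed

lemma norm_scaleC: "norm (scaleC c f) = cmod c * norm f"
proof -
  have "cinner (scaleC c f) (scaleC c f) = c * cnj c * cinner f f"
    using cinner_commute[of f "scaleC c f"] cinner_commute[of f f]
    by (simp add: cinner_scaleC_left mult_ac)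
  also have "c * cnj c = complex_of_real ((cmod c)\<^sup>2)"
    by (rule complex_norm_square[symmetric])
  finally have "inner (scaleC c f) (scaleC c f) = (cmod c)\<^sup>2 * inner f f"
    by (simp add: inner_L2_def)
  then show ?thesis
    by (simp add: norm_L2_def real_sqrt_mult)
qed

lemma subspace_closure_L2:
  assumes "L2.subspace V"
  shows "L2.subspace (closure V)"
proof (rule L2.subspaceI)
  show "0 \<in> closure V"
    using assms closure_subset by (auto simp: L2.subspace_def)
  fix x y assume "x \<in> closure V" "y \<in> closure V"
  then obtain X Y where "\<And>n. X n \<in> V" "X \<longlonglongrightarrow> x" "\<And>n. Y n \<in> V" "Y \<longlonglongrightarrow> y"
    by (auto simp: closure_sequential)
  then show "x + y \<in> closure V"
    using assms unfolding closure_sequential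
    by (intro exI[of _ "\<lambda>n. X n + Y n"]) (auto intro: tendsto_add L2.subspace_add)
next
  fix c x assume "x \<in> closure V"
  then obtain X where X: "\<And>n. X n \<in> V" "X \<longlonglongrightarrow> x"
    by (auto simp: closure_sequential)
  have "(\<lambda>n. cmod c * norm (X n - x)) \<longlonglongrightarrow> cmod c * 0"
    using X(2) by (intro tendsto_mult tendsto_const) (simp add: LIM_zero tendsto_norm_zero)
  then have "(\<lambda>n. scaleC c (X n)) \<longlonglongrightarrow> scaleC c x"
    by (simp flip: norm_scaleC add: L2.scale_right_diff_distrib tendsto_norm_zero_iff LIM_zero_iff)
  then show "scaleC c x \<in> closure V"
    using assms X(1) unfolding closure_sequential
    by (intro exI[of _ "\<lambda>n. scaleC c (X n)"]) (auto intro: L2.subspace_scale)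
qed

text \<open>
  By the Stone-Weierstrass theorem, polynomials in the real and imaginary part converge to \<open>f\<close> uniformly on
  the circle, and on the circle such polynomials are Laurent polynomials.
\<close>

lemma continuous_in_closed_span:
  assumes "continuous_on (sphere 0 1) f"
  shows "f \<in> L_infinity" "abs_L2 f \<in> closed_span (range monomial)"
proof -
  have f [measurable]: "f \<in> borel_measurable circle"
    unfolding borel_measurable_circle_eq using assms by (rule borel_measurable_continuous_on_restrict)
  have "bounded (f ` sphere 0 1)"
    by (intro compact_imp_bounded compact_continuous_image assms compact_sphere)
  then obtain B where B: "\<And>z. z \<in> sphere 0 1 \<Longrightarrow> cmod (f z) \<le> B"
    unfolding bounded_iff by blast
  show fL: "f \<in> L_infinity"
    unfolding L_infinity_def using f B by (auto intro!: exI[of _ B] AE_circleI)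
  have "\<exists>p. polynomial_function p \<and> (\<forall>z\<in>sphere 0 1. norm (f z - p z) < inverse (real (Suc n)))" for n
    by (rule Stone_Weierstrass_polynomial_function[OF compact_sphere assms]) auto
  then obtain p where p: "\<And>n. polynomial_function (p n)"
    and fp: "\<And>n z. z \<in> sphere 0 1 \<Longrightarrow> norm (f z - p n z) < inverse (real (Suc n))"
    by metis
  have lp: "p n \<in> square_integrable" "abs_L2 (p n) \<in> L2.span (range monomial)" for n
    using laurent_in_span[OF laurent_polynomial[OF p]] by auto
  have "(\<lambda>n. abs_L2 (p n)) \<longlonglongrightarrow> abs_L2 f"
  proof (rule L2_tendsto_dominated)
    show "(\<lambda>_. complex_of_real (\<bar>B\<bar> + 1)) \<in> square_integrable"
      by (intro L_infinity_square_integrable) (auto simp: L_infinity_def)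
    fix z :: complex assume z: "z \<in> sphere 0 1"
    have "(\<lambda>n. f z - p n z) \<longlonglongrightarrow> 0"
      by (rule Lim_null_comparison[OF _ LIMSEQ_inverse_real_of_nat])
         (use fp[OF z, THEN less_imp_le] in \<open>auto intro: always_eventually\<close>)
    from tendsto_diff[OF tendsto_const[of "f z"] this] show "(\<lambda>n. p n z) \<longlonglongrightarrow> f z" by simp
    fix n
    have "cmod (p n z) \<le> cmod (f z) + norm (f z - p n z)"
      using norm_triangle_ineq4[of "f z" "f z - p n z"] by simp
    also have "inverse (real (Suc n)) \<le> 1" by (simp add: field_simps)
    then have "norm (f z - p n z) \<le> 1" using fp[OF z, of n] by linarith
    finally show "cmod (p n z) \<le> cmod (complex_of_real (\<bar>B\<bar> + 1))"
      using B[OF z] by simp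
  qed (use lp fL in \<open>auto intro: L_infinity_square_integrable\<close>)
  then show "abs_L2 f \<in> closed_span (range monomial)"
    unfolding closed_span_def closure_sequential by (intro exI[of _ "\<lambda>n. abs_L2 (p n)"] conjI allI lp)
qed

lemma indicator_L_infinity: "B \<in> sets borel \<Longrightarrow> (indicator B :: complex \<Rightarrow> complex) \<in> L_infinity"
  unfolding L_infinity_def
  by (auto intro!: borel_measurable_circleI exI[of _ 1] AE_circleI simp: indicator_def)

lemma closed_span_closed_sequentially:
  "(\<And>n. X n \<in> closed_span V) \<Longrightarrow> X \<longlonglongrightarrow> x \<Longrightarrow> x \<in> closed_span V"
  unfolding closed_span_def by (rule closed_sequentially[OF closed_closure])

lemma subspace_closed_span: "L2.subspace (closed_span V)"
  unfolding closed_span_def by (intro subspace_closure_L2 L2.subspace_span)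

lemma const_square_integrable: "(\<lambda>_. c) \<in> square_integrable"
  by (intro L_infinity_square_integrable) (auto simp: L_infinity_def)

text \<open>
  For nonempty \<open>F\<close> the indicator is the pointwise limit of the continuous functions \<open>max 0 (1 - n * dist z F)\<close>.
\<close>

lemma closed_indicator_in_closed_span:
  assumes "closed F"
  shows "abs_L2 (indicator F) \<in> closed_span (range monomial)"
proof (cases "F = {}")
  case True
  then have "abs_L2 (indicator F) = 0" by (simp add: zero_L2_def indicator_def[abs_def])
  then show ?thesis using L2.subspace_0[OF subspace_closed_span] by simp
next
  case False
  define f where "f n z = complex_of_real (max 0 (1 - real n * infdist z F))" for n z
  have cont: "continuous_on (sphere 0 1) (f n)" for n
    unfolding f_def by (intro continuous_intros)
  show ?thesis
  proof (rule closed_span_closed_sequentially)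
    show "abs_L2 (f n) \<in> closed_span (range monomial)" for n
      by (rule continuous_in_closed_span(2)[OF cont])
    show "(\<lambda>n. abs_L2 (f n)) \<longlonglongrightarrow> abs_L2 (indicator F)"
    proof (rule L2_tendsto_dominated[where w="\<lambda>_. 1"])
      fix z :: complex
      show "(\<lambda>n. f n z) \<longlonglongrightarrow> indicator F z"
      proof (cases "z \<in> F")
        case True
        then show ?thesis by (simp add: f_def)
      next
        case zF: False
        then have d: "infdist z F > 0"
          using in_closed_iff_infdist_zero[OF assms False] infdist_nonneg[of z F] by auto
        obtain k where k: "1 < real k * infdist z F"
          using reals_Archimedean3[OF d] by blast
        have "f n z = 0" if "n \<ge> k" for n
        proof -
          have "real k * infdist z F \<le> real n * infdist z F"
            using that d by (intro mult_right_mono) auto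
          then show ?thesis using k by (simp add: f_def max_def)
        qed
        then have "eventually (\<lambda>n. f n z = indicator F z) sequentially"
          unfolding eventually_sequentially using zF by (intro exI[of _ k]) auto
        then show ?thesis by (rule tendsto_eventually)
      qed
      fix n
      have "\<bar>max 0 (1 - real n * infdist z F)\<bar> \<le> 1" using infdist_nonneg[of z F] by (auto simp: max_def)
      then show "cmod (f n z) \<le> cmod 1" unfolding f_def norm_of_real by simp
    qed (use cont assms in \<open>auto intro: L_infinity_square_integrable continuous_in_closed_span(1) borel_closed
          const_square_integrable indicator_L_infinity borel_closed\<close>)
  qed
qed

text \<open>
  The sets in question form a Dynkin system, and the closed sets are an intersection-stable generator of
  the Borel sets.
\<close>

lemma borel_indicator_in_closed_span:
  assumes "B \<in> sets borel"
  shows "abs_L2 (indicator B) \<in> closed_span (range monomial)"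
proof -
  have sb: "sets borel = sigma_sets UNIV (Collect closed :: complex set set)"
    by (simp add: borel_eq_closed)
  have ind: "indicator B \<in> square_integrable" if "B \<in> sets borel" for B :: "complex set"
    using that by (intro L_infinity_square_integrable indicator_L_infinity)
  have "Int_stable (Collect closed :: complex set set)" by (auto simp: Int_stable_def)
  moreover have "Collect closed \<subseteq> Pow (UNIV :: complex set)" by simp
  ultimately show ?thesis
    using assms unfolding sb
  proof (induction B rule: sigma_sets_induct_disjoint)
    case (basic A)
    then show ?case by (simp add: closed_indicator_in_closed_span)
  next
    case empty
    show ?case by (rule closed_indicator_in_closed_span) simp
  next
    case (compl A)
    then have A: "A \<in> sets borel" by (simp add: sb)
    have "abs_L2 (\<lambda>z. indicator UNIV z - indicator A z) = abs_L2 (indicator UNIV) - abs_L2 (indicator A)"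
      using A by (intro abs_L2_diff[symmetric] ind) auto
    moreover have "(\<lambda>z. indicator UNIV z - indicator A z) = (indicator (UNIV - A) :: complex \<Rightarrow> complex)"
      by (auto simp: indicator_def)
    moreover have "abs_L2 (indicator UNIV) \<in> closed_span (range monomial)"
      by (rule closed_indicator_in_closed_span) simp
    ultimately show ?case
      using L2.subspace_diff[OF subspace_closed_span] compl.IH by metis
  next
    case (union A)
    then have A: "A i \<in> sets borel" for i by (auto simp: sb)
    define f where "f n z = (\<Sum>i<n. indicator (A i) z :: complex)" for n z
    have f: "f n = indicator (\<Union>i<n. A i)" for n
      using union.hyps(1) unfolding f_def
      by (intro ext indicator_UN_disjoint[symmetric]) (auto intro: disjoint_family_on_mono)
    show ?case
    proof (rule closed_span_closed_sequentially)
      have "abs_L2 (f n) = (\<Sum>i<n. abs_L2 (indicator (A i)))" for n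
        unfolding f_def by (intro abs_L2_sum ind A)
      then show "abs_L2 (f n) \<in> closed_span (range monomial)" for n
        using union.IH by (auto intro: L2.subspace_sum[OF subspace_closed_span])
      show "(\<lambda>n. abs_L2 (f n)) \<longlonglongrightarrow> abs_L2 (indicator (\<Union>i. A i))"
      proof (rule L2_tendsto_dominated[where w="\<lambda>_. 1"])
        show "(\<lambda>n. f n z) \<longlonglongrightarrow> indicator (\<Union>i. A i) z" for z
        proof (cases "z \<in> (\<Union>i. A i)")
          case True
          then obtain i where "z \<in> A i" by blast
          then have "eventually (\<lambda>n. f n z = indicator (\<Union>i. A i) z) sequentially"
            unfolding eventually_sequentially f by (intro exI[of _ "Suc i"]) (auto simp: indicator_def Suc_le_eq)
          then show ?thesis by (rule tendsto_eventually)
        qed (simp add: f)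
        show "cmod (f n z) \<le> cmod 1" for n z by (simp add: f indicator_def)
        show "f n \<in> square_integrable" for n unfolding f using A by (intro ind) auto
        show "indicator (\<Union>i. A i) \<in> square_integrable" using A by (intro ind) auto
      qed (rule const_square_integrable)
    qed
  qed
qed

text \<open>
  A square integrable \<open>f\<close> is the pointwise limit of simple functions bounded by \<open>2 * cmod f\<close>.
\<close>

theorem closed_span_monomial: "closed_span (range monomial) = UNIV"
proof -
  have "f' \<in> closed_span (range monomial)" for f'
  proof -
    obtain f where f: "f \<in> square_integrable" "f' = abs_L2 f"
      using rep_L2_square_integrable abs_rep_L2 by metis
    from borel_measurable_implies_sequence_metric[OF square_integrable_measurable[OF f(1)], of 0]
    obtain F where F: "\<And>n. simple_function circle (F n)"
      "\<And>z. z \<in> sphere 0 1 \<Longrightarrow> (\<lambda>n. F n z) \<longlonglongrightarrow> f z"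
      "\<And>n z. z \<in> sphere 0 1 \<Longrightarrow> cmod (F n z) \<le> 2 * cmod (f z)"
      unfolding space_circle dist_norm diff_0_right by metis
    have "F n \<in> square_integrable \<and> abs_L2 (F n) \<in> closed_span (range monomial)" for n
    proof -
      have fin: "finite (F n ` space circle)" using F(1) by (rule simple_functionD)
      have "\<exists>B. B \<in> sets borel \<and> F n -` {y} \<inter> space circle = sphere 0 1 \<inter> B" for y
      proof -
        have "F n -` {y} \<inter> space circle \<in> sets circle"
          using F(1) by (rule simple_functionD)
        then show ?thesis
          by (auto simp: circle_def sets_restrict_space)
      qed
      then obtain B where B: "\<And>y. B y \<in> sets borel"
        "\<And>y. F n -` {y} \<inter> space circle = sphere 0 1 \<inter> B y" by metis
      \<comment> \<open>On the circle, \<open>F n\<close> is a linear combination of indicators of Borel sets of the plane.\<close>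
      define H where "H z = (\<Sum>y\<in>F n ` space circle. y * indicator (B y) z)" for z
      have FH: "F n z = H z" if z: "z \<in> sphere 0 1" for z
      proof -
        have eq: "y * indicator (B y) z = (if F n z = y then y else 0)" for y
        proof -
          have "z \<in> sphere 0 1 \<inter> B y \<longleftrightarrow> F n z = y"
            unfolding B(2)[symmetric] using z by (simp add: space_circle)
          then have "z \<in> B y \<longleftrightarrow> F n z = y" using z by blast
          then show ?thesis by (simp only: indicator_def of_bool_def mult_1_right mult_zero_right split: if_split) simp
        qed
        have "F n z \<in> F n ` space circle" using z unfolding space_circle by (rule imageI)
        then show ?thesis
          unfolding H_def eq by (simp only: sum.delta'[OF fin] if_True)
      qed
      have ind: "indicator (B y) \<in> square_integrable" for y
        using B(1) by (intro L_infinity_square_integrable indicator_L_infinity)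
      have H: "H \<in> square_integrable"
        unfolding H_def by (intro square_integrable_sum square_integrable_cmult ind)
      have "abs_L2 H = (\<Sum>y\<in>F n ` space circle. scaleC y (abs_L2 (indicator (B y))))"
        unfolding H_def by (subst abs_L2_sum) (auto simp: abs_L2_scaleC ind intro: square_integrable_cmult)
      also have "\<dots> \<in> closed_span (range monomial)"
        by (intro L2.subspace_sum L2.subspace_scale subspace_closed_span borel_indicator_in_closed_span B)
      finally have HW: "abs_L2 H \<in> closed_span (range monomial)" .
      have Fs: "F n \<in> square_integrable" using square_integrable_cong[OF H] FH by simp
      moreover have "abs_L2 (F n) = abs_L2 H"
        using FH by (intro abs_L2_eqI Fs H AE_circleI)
      ultimately show ?thesis using HW by simp
    qed
    then have Fn: "F n \<in> square_integrable" "abs_L2 (F n) \<in> closed_span (range monomial)" for n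
      by auto
    have lim: "(\<lambda>n. abs_L2 (F n)) \<longlonglongrightarrow> f'"
      unfolding f(2)
    proof (rule L2_tendsto_dominated[where w="\<lambda>z. 2 * f z"])
      show "(\<lambda>z. 2 * f z) \<in> square_integrable" by (rule square_integrable_cmult[OF f(1)])
      show "cmod (F n z) \<le> cmod (2 * f z)" if "z \<in> sphere 0 1" for n z
        using F(3)[OF that, of n] by (simp add: norm_mult)
    qed (fact Fn(1) f(1) F(2))+
    show ?thesis
      by (rule closed_span_closed_sequentially[OF Fn(2) lim])
  qed
  then show ?thesis by auto
qed

section \<open>Spectra of functions\<close>

lemma cinner_add_right: "cinner f (g + h) = cinner f g + cinner f h"
  by (metis cinner_commute cinner_add_left complex_cnj_add)

lemma cinner_scaleC_right: "cinner f (scaleC c g) = cnj c * cinner f g"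
  by (metis cinner_commute cinner_scaleC_left complex_cnj_mult)

lemma cinner_zero_right: "cinner f 0 = 0"
  using cinner_scaleC_right[of f 0 f] by simp

lemma cinner_diff_right: "cinner f (g - h) = cinner f g - cinner f h"
  using cinner_add_right[of f "g - h" h] by (simp add: algebra_simps)

lemma cinner_sum_left: "cinner (\<Sum>i\<in>I. f i) g = (\<Sum>i\<in>I. cinner (f i) g)"
  using cinner_scaleC_left[of 0 0 g]
  by (induction I rule: infinite_finite_induct) (simp_all add: cinner_add_left)

lemma cinner_sum_right: "cinner f (\<Sum>i\<in>I. g i) = (\<Sum>i\<in>I. cinner f (g i))"
  by (induction I rule: infinite_finite_induct) (simp_all add: cinner_add_right cinner_zero_right)

lemma cinner_eqI:
  assumes "\<And>f. cinner f g = cinner f h"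
  shows "g = h"
proof -
  have "cinner (g - h) (g - h) = 0" by (simp add: cinner_diff_right assms)
  then show ?thesis by (simp add: cinner_self(3))
qed

lemma cinner_monomial: "cinner (monomial k) (monomial n) = (if k = n then 1 else 0)"
proof -
  have "cinner (monomial k) (monomial n) = (\<integral>z. z powi k * cnj (z powi n) \<partial>circle)"
    unfolding monomial_def by (simp add: cinner_abs powi_square_integrable)
  also have "\<dots> = (\<integral>z. z powi (k - n) \<partial>circle)"
  proof (intro Bochner_Integration.integral_cong refl)
    fix z assume "z \<in> space circle"
    then have z: "cmod z = 1" "z \<noteq> 0" by (auto simp: space_circle)
    have "z powi n * cnj (z powi n) = 1"
      using z complex_norm_square[of "z powi n"] by (simp add: norm_power_int)
    then have "cnj (z powi n) = inverse (z powi n)" by (simp add: inverse_unique)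
    then show "z powi k * cnj (z powi n) = z powi (k - n)"
      using z by (simp add: power_int_diff divide_inverse)
  qed
  finally show ?thesis by (simp add: integral_circle_powi)
qed

text \<open>
  Such an \<open>h\<close> is orthogonal to the trigonometric polynomials and, being a limit of them, to itself.
\<close>

lemma orthogonal_monomials_imp_zero:
  assumes "\<And>k. cinner (monomial k) h = 0"
  shows "h = 0"
proof -
  have span: "cinner f h = 0" if "f \<in> L2.span (range monomial)" for f
    using that
  proof (induction rule: L2.span_induct_alt)
    case base
    show ?case using cinner_scaleC_left[of 0 0 h] by simp
  next
    case (step c x y)
    then show ?case using assms by (auto simp: cinner_add_left cinner_scaleC_left)
  qed
  have "h \<in> closure (L2.span (range monomial))"
    using closed_span_monomial by (simp add: closed_span_def)
  then obtain X where X: "\<And>n. X n \<in> L2.span (range monomial)" "X \<longlonglongrightarrow> h"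
    by (auto simp: closure_sequential)
  have "(\<lambda>n. inner (X n) h) \<longlonglongrightarrow> inner h h"
    by (intro tendsto_inner X tendsto_const)
  then have "inner h h = 0"
    using X(1) span by (simp add: inner_L2_def LIMSEQ_const_iff)
  then show ?thesis by simp
qed

text \<open>
  A function with finite spectrum \<open>I\<close> equals the corresponding Fourier sum, because their difference has
  vanishing Fourier coefficients.
\<close>

lemma in_span_monomials:
  assumes I: "finite I" and h: "\<And>k. k \<notin> I \<Longrightarrow> cinner (monomial k) h = 0"
  shows "h \<in> L2.span (monomial ` I)"
proof -
  define p where "p = (\<Sum>k\<in>I. scaleC (cinner h (monomial k)) (monomial k))"
  have conj: "cnj (cinner h (monomial k)) = cinner (monomial k) h" for k
    by (rule cinner_commute[symmetric])
  have "cinner (monomial n) p = cinner (monomial n) h" for n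
  proof -
    have "cinner (monomial n) p = (\<Sum>k\<in>I. if k = n then cinner (monomial n) h else 0)"
      unfolding p_def cinner_sum_right cinner_scaleC_right cinner_monomial conj
      by (intro sum.cong refl) auto
    also have "\<dots> = cinner (monomial n) h" using I h by simp
    finally show ?thesis .
  qed
  then have "h - p = 0"
    by (intro orthogonal_monomials_imp_zero) (simp add: cinner_diff_right)
  moreover have "p \<in> L2.span (monomial ` I)"
    unfolding p_def by (intro L2.span_sum L2.span_scale L2.span_base) auto
  ultimately show ?thesis by simp
qed

lemma adjoint_pair_sym: "adjoint_pair T U \<Longrightarrow> adjoint_pair U T"
  unfolding adjoint_pair_def by (metis cinner_commute)

lemma adjoint_pair_imp_cadjoint:
  assumes "adjoint_pair T U"
  shows "adjoint_pair T (cadjoint T)"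
proof -
  have "cadjoint T = U"
    using assms unfolding adjoint_pair_def by (intro cadjoint_eqI) simp
  then show ?thesis using assms by simp
qed

text \<open>
  Inner products with \<open>U f\<close> depend linearly on \<open>f\<close> because they can be moved to the other side of the
  pairing; hence linearity is automatic for a map that has an adjoint.
\<close>

lemma adjoint_pair_right_linear:
  assumes "adjoint_pair T U"
  shows "U (f + g) = U f + U g" "U (scaleC c f) = scaleC c (U f)" "U 0 = 0"
proof -
  have a: "cinner h (U f) = cinner (T h) f" for h f using assms by (simp add: adjoint_pair_def)
  show "U (f + g) = U f + U g" "U (scaleC c f) = scaleC c (U f)" "U 0 = 0"
    by (rule cinner_eqI; simp add: a cinner_add_right cinner_scaleC_right cinner_zero_right)+
qed

lemma adjoint_pair_maps_span:
  assumes "adjoint_pair T U" "L2.subspace W" "\<And>f. f \<in> V \<Longrightarrow> U f \<in> W" "f \<in> L2.span V"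
  shows "U f \<in> W"
  using assms(4)
proof (induction rule: L2.span_induct_alt)
  case base
  then show ?case using assms(2) by (simp add: adjoint_pair_right_linear[OF assms(1)] L2.subspace_0)
next
  case (step c x y)
  then show ?case
    using assms(2,3) by (simp add: adjoint_pair_right_linear[OF assms(1)] L2.subspace_add L2.subspace_scale)
qed

definition trig_polynomials :: "nat \<Rightarrow> L2 set" where
  "trig_polynomials d = L2.span (monomial ` {- int d..int d})"

text \<open>
  If \<open>m\<close> is the sum of \<open>a l * z powi l\<close>, then \<open>z powi k\<close> is mapped to the sum of
  \<open>a l * z powi (N * k + l)\<close>.
\<close>

lemma filter_operator_monomial:
  assumes N: "N > 0" and m: "m \<in> L_infinity" and d: "fourier_polynomial d m"
  shows "filter_operator N m (monomial k) \<in> L2.span (monomial ` {int N * k - int d..int N * k + int d})"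
proof -
  obtain a where a: "AE z in circle. m z = (\<Sum>l = - int d..int d. a l * z powi l)"
    using d by (auto simp: fourier_polynomial_def)
  have sq: "(\<lambda>z. a l * z powi (int N * k + l)) \<in> square_integrable" for l
    by (intro square_integrable_cmult powi_square_integrable)
  have eq: "(\<Sum>l = - int d..int d. a l * z powi l) * (z ^ N) powi k
      = (\<Sum>l = - int d..int d. a l * z powi (int N * k + l))" if "z \<in> sphere 0 1" for z
  proof -
    have "z \<noteq> 0" using that by auto
    moreover have "(z ^ N) powi k = z powi (int N * k)"
      by (simp add: power_int_mult)
    ultimately show ?thesis
      unfolding sum_distrib_right by (intro sum.cong refl) (simp add: power_int_add mult_ac)
  qed
  have "filter_operator N m (monomial k) = abs_L2 (\<lambda>z. m z * (z ^ N) powi k)"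
    unfolding monomial_def by (intro filter_operator_abs N m powi_square_integrable)
  also have "\<dots> = abs_L2 (\<lambda>z. \<Sum>l = - int d..int d. a l * z powi (int N * k + l))"
  proof (rule abs_L2_eqI)
    show "(\<lambda>z. m z * (z ^ N) powi k) \<in> square_integrable"
      by (intro filter_integrand_square_integrable[where f="\<lambda>z. z powi k"] N m powi_square_integrable)
    show "AE z in circle. m z * (z ^ N) powi k = (\<Sum>l = - int d..int d. a l * z powi (int N * k + l))"
      using a AE_space
    proof eventually_elim
      case (elim z)
      then show ?case using eq[of z] by (simp add: space_circle)
    qed
  qed (intro square_integrable_sum sq)
  also have "\<dots> = (\<Sum>l = - int d..int d. scaleC (a l) (monomial (int N * k + l)))"
    by (subst abs_L2_sum) (simp_all add: sq monomial_def abs_L2_scaleC powi_square_integrable)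
  also have "\<dots> \<in> L2.span (monomial ` {int N * k - int d..int N * k + int d})"
    by (intro L2.span_sum L2.span_scale L2.span_base) auto
  finally show ?thesis .
qed

lemma cinner_span_monomials:
  assumes "f \<in> L2.span (monomial ` I)" "g \<in> L2.span (monomial ` J)" "I \<inter> J = {}"
  shows "cinner f g = 0"
proof -
  have mono: "cinner f (monomial n) = 0" if "f \<in> L2.span (monomial ` I)" "n \<notin> I" for f n
    using that(1)
  proof (induction rule: L2.span_induct_alt)
    case base
    show ?case using cinner_scaleC_left[of 0 0] by simp
  next
    case (step c x y)
    then show ?case using that(2) by (auto simp: cinner_add_left cinner_scaleC_left cinner_monomial split: if_splits)
  qed
  from assms(2) show ?thesis
  proof (induction rule: L2.span_induct_alt)
    case base
    show ?case by (rule cinner_zero_right)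
  next
    case (step c x y)
    then show ?case
      using assms(1,3) mono[OF assms(1)] by (auto simp: cinner_add_right cinner_scaleC_right)
  qed
qed

text \<open>
  The adjoint of a filter operator roughly divides the degree by \<open>N\<close>.  The coefficient of \<open>U f\<close> at \<open>k\<close>
  is the inner product of the image of \<open>z powi k\<close>, whose spectrum lies within \<open>d\<close> of \<open>N * k\<close>, with \<open>f\<close>,
  whose spectrum lies within \<open>D\<close> of \<open>0\<close>.  If \<open>\<bar>k\<bar> > D'\<close>, then \<open>N * \<bar>k\<bar> > D + d\<close> and the spectra are
  disjoint.
\<close>

lemma adjoint_filter_trig:
  assumes N: "N > 0" and m: "m \<in> L_infinity" and d: "fourier_polynomial d m"
    and U: "adjoint_pair (filter_operator N m) U" and f: "f \<in> trig_polynomials D"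
    and D': "D + d < N * (D' + 1)"
  shows "U f \<in> trig_polynomials D'"
  unfolding trig_polynomials_def
proof (rule in_span_monomials)
  fix k assume "k \<notin> {- int D'..int D'}"
  then have k: "\<bar>k\<bar> \<ge> int D' + 1" by auto
  have "int N * \<bar>k\<bar> \<ge> int N * (int D' + 1)" using k by (intro mult_left_mono) auto
  moreover have "int N * (int D' + 1) > int D + int d"
    using D' by (metis of_nat_add of_nat_less_iff of_nat_mult of_nat_1)
  ultimately have "\<bar>int N * k\<bar> > int D + int d" by (simp add: abs_mult)
  then have disj: "{int N * k - int d..int N * k + int d} \<inter> {- int D..int D} = {}" by auto
  have "cinner (monomial k) (U f) = cinner (filter_operator N m (monomial k)) f"
    using U by (simp add: adjoint_pair_def)
  also have "\<dots> = 0"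
    by (rule cinner_span_monomials[OF filter_operator_monomial[OF N m d] f[unfolded trig_polynomials_def] disj])
  finally show "cinner (monomial k) (U f) = 0" .
qed simp

section \<open>Cyclicity\<close>

lemma word_operator_Cons: "word_operator S (i # w) f = S i (word_operator S w f)"
  by (simp add: word_operator_def)

text \<open>
  Let \<open>V\<close> be the linear span of the images of \<open>P M\<close> under nonempty words; each \<open>A i\<close> maps \<open>P M\<close> and \<open>V\<close> into
  \<open>V\<close>.  An element of \<open>P (Suc D)\<close> is the sum of the \<open>A i (B i f)\<close>, where \<open>B i f\<close> has lower degree and
  so lies in \<open>V\<close> by induction; thus it lies in \<open>V\<close> itself.  The same identity for \<open>f\<close> in \<open>P M\<close> starts the
  induction and accounts for the words being nonempty.  Having an adjoint makes \<open>A i\<close> linear, so that it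
  suffices to check on words that \<open>A i\<close> preserves \<open>V\<close>.
\<close>

lemma cyclic_subspace:
  fixes A A' B :: "nat \<Rightarrow> L2 \<Rightarrow> L2" and P :: "nat \<Rightarrow> L2 set"
  assumes A: "\<And>i. i < N \<Longrightarrow> adjoint_pair (A' i) (A i)"
    and id: "\<And>f. (\<Sum>i<N. A i (B i f)) = f"
    and base: "\<And>i f. i < N \<Longrightarrow> f \<in> P M \<Longrightarrow> B i f \<in> P M"
    and step: "\<And>i f D. i < N \<Longrightarrow> D \<ge> M \<Longrightarrow> f \<in> P (Suc D) \<Longrightarrow> B i f \<in> P D"
    and D: "D \<ge> M"
  shows "P D \<subseteq> L2.span (\<Union>w\<in>nonempty_words N. word_operator A w ` P M)" (is "_ \<subseteq> L2.span ?V")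
proof -
  have AV: "A i f \<in> L2.span ?V" if "i < N" "f \<in> L2.span ?V" for i f
  proof (rule adjoint_pair_maps_span[OF A[OF that(1)] L2.subspace_span _ that(2)])
    fix h assume "h \<in> ?V"
    then obtain w u where w: "w \<in> nonempty_words N" "u \<in> P M" "h = word_operator A w u" by blast
    then have "i # w \<in> nonempty_words N" "A i h = word_operator A (i # w) u"
      using that(1) by (simp_all add: nonempty_words_def word_operator_Cons)
    then show "A i h \<in> L2.span ?V" using w by (intro L2.span_base) blast
  qed
  have AP: "A i f \<in> L2.span ?V" if "i < N" "f \<in> P M" for i f
  proof -
    have "[i] \<in> nonempty_words N" "A i f = word_operator A [i] f"
      using that(1) by (auto simp: nonempty_words_def word_operator_def)
    then show ?thesis using that(2) by (intro L2.span_base) blast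
  qed
  show ?thesis
    using D
  proof (induction rule: dec_induct)
    case base
    have "(\<Sum>i<N. A i (B i f)) \<in> L2.span ?V" if "f \<in> P M" for f
      using that assms(3) AP by (intro L2.span_sum) simp
    then show ?case unfolding id by (rule subsetI)
  next
    case (step D)
    have "(\<Sum>i<N. A i (B i f)) \<in> L2.span ?V" if "f \<in> P (Suc D)" for f
      using that assms(4) step AV by (intro L2.span_sum) blast
    then show ?case unfolding id by (rule subsetI)
  qed
qed

theorem theorem3p3:
  fixes N g :: nat
    and m m' :: "nat \<Rightarrow> complex \<Rightarrow> complex"
    and S S' :: "nat \<Rightarrow> L2 \<Rightarrow> L2"
  assumes "N \<ge> 2" and "g \<ge> 1"
    and "biorthogonal_wavelet_rep N m m' S S'"
    and "compactly_supported N g m m'"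
  shows "\<exists>K. finite_dim_subspace K \<and>
    (\<forall>i<N. cadjoint (S i) ` K \<subseteq> K \<and> cadjoint (S' i) ` K \<subseteq> K) \<and>
    closed_span (\<Union>w\<in>nonempty_words N. word_operator S w ` K) = UNIV \<and>
    closed_span (\<Union>w\<in>nonempty_words N. word_operator S' w ` K) = UNIV"
proof (intro exI conjI allI impI)
  define K where "K = trig_polynomials (2 * g)"
  define T where "T i = cadjoint (S i)" for i
  define T' where "T' i = cadjoint (S' i)" for i
  have N: "N > 0" using assms(1) by simp
  have m: "m i \<in> L_infinity" "m' i \<in> L_infinity" "S i = filter_operator N (m i)" "S' i = filter_operator N (m' i)"
    "fourier_polynomial (N * g - 1) (m i)" "fourier_polynomial (N * g - 1) (m' i)" if "i < N" for i
    using assms(3,4) that by (auto simp: biorthogonal_wavelet_rep_def compactly_supported_def)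
  have adj: "adjoint_pair (S i) (T i)" "adjoint_pair (S' i) (T' i)" if "i < N" for i
    unfolding T_def T'_def m(3,4)[OF that]
    by (intro adjoint_pair_imp_cadjoint[OF adjoint_pair_transfer_operator] N m(1,2)[OF that])+
  have id: "(\<Sum>i<N. S i (T' i f)) = f" for f
    using assms(3) unfolding biorthogonal_wavelet_rep_def T'_def by blast
  \<comment> \<open>The adjoint of the reproducing identity, with the roles of \<open>S\<close> and \<open>S'\<close> exchanged.\<close>
  have id': "(\<Sum>i<N. S' i (T i f)) = f" for f
  proof (rule cinner_eqI)
    fix h
    have "cinner h (\<Sum>i<N. S' i (T i f)) = (\<Sum>i<N. cinner (S i (T' i h)) f)"
      unfolding cinner_sum_right
      using adj adj[THEN adjoint_pair_sym] by (intro sum.cong refl) (simp add: adjoint_pair_def)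
    then show "cinner h (\<Sum>i<N. S' i (T i f)) = cinner h f"
      by (simp flip: cinner_sum_left add: id)
  qed
  have shrink: "T i f \<in> trig_polynomials D'" "T' i f \<in> trig_polynomials D'"
    if "i < N" "f \<in> trig_polynomials D" "D + (N * g - 1) < N * (D' + 1)" for i f D D'
    using adjoint_filter_trig[OF N m(1)[OF that(1)] m(5)[OF that(1)]
        adj(1)[OF that(1), unfolded m(3)[OF that(1)]] that(2,3)]
      adjoint_filter_trig[OF N m(2)[OF that(1)] m(6)[OF that(1)]
        adj(2)[OF that(1), unfolded m(4)[OF that(1)]] that(2,3)] .
  \<comment> \<open>With filters of degree \<open>N * g - 1\<close> the bound \<open>2 * g\<close> on the degree is preserved by the adjoints, and any
      higher degree is strictly lowered; both inequalities use \<open>N \<ge> 2\<close>.\<close>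
  have gN: "N * g \<ge> 1" using N assms(2) by simp
  have base: "2 * g + (N * g - 1) < N * (2 * g + 1)"
  proof -
    have "2 * g \<le> N * g" using assms(1) by simp
    moreover have "N * (2 * g + 1) = N * g + N * g + N" by (simp add: algebra_simps)
    ultimately show ?thesis using gN assms(1) by linarith
  qed
  have step: "Suc D + (N * g - 1) < N * (D + 1)" if "2 * g \<le> D" for D
  proof -
    have "N * (2 * g) + 2 * D \<le> N * D + 2 * (2 * g)"
    proof -
      \<comment> \<open>The inequality is \<open>(N - 2) * (D - 2 * g) \<ge> 0\<close>.\<close>
      obtain e where "D = 2 * g + e" using le_Suc_ex[OF \<open>2 * g \<le> D\<close>] by blast
      moreover obtain n where "N = 2 + n" using le_Suc_ex[OF assms(1)] by blast
      ultimately show ?thesis by (simp add: algebra_simps)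
    qed
    moreover have "2 * g \<le> N * g" using assms(1) by simp
    moreover have "N * (D + 1) = N * D + N" "N * (2 * g) = 2 * (N * g)" by (simp_all add: algebra_simps)
    ultimately show ?thesis using gN assms(1) that by linarith
  qed
  have dense: "closed_span V = UNIV" if V: "\<And>D. D \<ge> 2 * g \<Longrightarrow> trig_polynomials D \<subseteq> L2.span V" for V
  proof -
    have "monomial k \<in> L2.span V" for k
    proof -
      have "monomial k \<in> trig_polynomials (max (2 * g) (nat \<bar>k\<bar>))"
        unfolding trig_polynomials_def by (intro L2.span_base imageI) auto
      then show ?thesis using V[of "max (2 * g) (nat \<bar>k\<bar>)"] by auto
    qed
    then have "L2.span (range monomial) \<subseteq> L2.span V"
      by (intro L2.span_minimal L2.subspace_span) auto
    then show ?thesis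
      using closed_span_monomial closure_mono unfolding closed_span_def by blast
  qed
  show "finite_dim_subspace K"
    unfolding finite_dim_subspace_def K_def trig_polynomials_def
    by (intro conjI L2.subspace_span exI[of _ "monomial ` {- int (2 * g)..int (2 * g)}"]) simp_all
  have stay: "T i f \<in> trig_polynomials (2 * g)" "T' i f \<in> trig_polynomials (2 * g)" if "i < N" "f \<in> trig_polynomials (2 * g)" for i f
    using shrink[OF that base] .
  have lower: "T i f \<in> trig_polynomials D" "T' i f \<in> trig_polynomials D" if "i < N" "2 * g \<le> D" "f \<in> trig_polynomials (Suc D)" for i f D
    using shrink[OF that(1,3) step[OF that(2)]] .
  show "cadjoint (S i) ` K \<subseteq> K" "cadjoint (S' i) ` K \<subseteq> K" if "i < N" for i
    using stay[OF that] unfolding K_def T_def T'_def by blast+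
  show "closed_span (\<Union>w\<in>nonempty_words N. word_operator S w ` K) = UNIV"
    unfolding K_def
    by (rule dense, rule cyclic_subspace[where P=trig_polynomials, OF adj(1)[THEN adjoint_pair_sym] id stay(2) lower(2)])
  show "closed_span (\<Union>w\<in>nonempty_words N. word_operator S' w ` K) = UNIV"
    unfolding K_def
    by (rule dense, rule cyclic_subspace[where P=trig_polynomials, OF adj(2)[THEN adjoint_pair_sym] id' stay(1) lower(1)])
qed

end
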